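(* There is a bijection between balanced blossom trees of total charge $2$ and $2$-leg maps that preserves the degree distribution $(\lambda,\mu)$.
   Context: All maps are planar, connected, considered up to orientation-preserving homeomorphism, and bipartite: vertices are black or white and each edge joins a black and a white vertex. Maps may carry half-edges attached to single vertices and lying in the infinite face. A half-edge at a white vertex is a leaf; one at a black vertex is a bud. Maps are rooted at a half-edge. Degrees count edges and half-edges. The degree distribution $(\lambda,\mu)$ is the pair of multisets of degrees of white and of black vertices. A $k$-leg map has exactly $k$ leaves and no buds, and is rooted at a leaf. A tree is such a map with one face. Its charge is the number of leaves minus the number of buds, not counting the root half-edge; the total charge counts it. For an edge $e$ of a tree $T$, cutting $e$ into a leaf at its white end and a bud at its black end yields $T_e^\bullet$ (containing the black end) and $T_e^\circ$ (containing the white end), each rooted at its new half-edge. The lower subtree at $e$ is the one not containing the root. A blossom tree is a tree such that, for every edge $e$: the lower subtree has charge $\ge0$ if it is $T_e^\circ$, and $\le1$ if it is $T_e^\bullet$. Going counterclockwise around a tree of total charge $k\ge1$, repeatedly match a bud immediately followed (among still unmatched half-edges) by a leaf. The $k$ leaves that remain unmatched are called single. A tree is balanced if it is rooted at a single leaf. *)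

theory Defs
  imports "HOL-Combinatorics.Permutations" "HOL-Combinatorics.Orbits"
begin

(* Planar maps are encoded combinatorially.  A dart is either one of the two sides of an edge or a
   dangling half-edge.  rot sends a dart to the next one in counterclockwise order around its
   vertex; opp exchanges the two sides of each edge and fixes exactly the dangling half-edges;
   white is the colour of the vertex carrying the dart.  Every finite map can be labelled by
   natural numbers, so this dart type entails no restriction. *)

record rooted_map =
  darts :: "nat set"
  rot :: "nat \<Rightarrow> nat"
  opp :: "nat \<Rightarrow> nat"
  white :: "nat \<Rightarrow> bool"
  root_dart :: nat

definition vertices :: "rooted_map \<Rightarrow> nat set set" where
  "vertices M = orbit (rot M) ` darts M"

definition half_edges :: "rooted_map \<Rightarrow> nat set" where
  "half_edges M = {d \<in> darts M. opp M d = d}"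

definition edges :: "rooted_map \<Rightarrow> nat set set" where
  "edges M = {{d, opp M d} | d. d \<in> darts M \<and> opp M d \<noteq> d}"

(* With counterclockwise rot, iterating contour walks along the boundary of a face, keeping that
   face on the right.  In particular a tree is walked around counterclockwise. *)
definition contour :: "rooted_map \<Rightarrow> nat \<Rightarrow> nat" where
  "contour M d = rot M (opp M d)"

definition faces :: "rooted_map \<Rightarrow> nat set set" where
  "faces M = orbit (contour M) ` darts M"

definition leaves :: "rooted_map \<Rightarrow> nat set" where
  "leaves M = {d \<in> half_edges M. white M d}"

definition buds :: "rooted_map \<Rightarrow> nat set" where
  "buds M = {d \<in> half_edges M. \<not> white M d}"

definition reachable :: "(nat \<Rightarrow> nat) \<Rightarrow> (nat \<Rightarrow> nat) \<Rightarrow> nat \<Rightarrow> nat set" where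
  "reachable s a d = {e. (\<lambda>x y. y = s x \<or> y = a x)\<^sup>*\<^sup>* d e}"

(* Connected bipartite plane maps rooted at a half-edge.  Planarity is Euler's formula (a dangling
   half-edge contributes neither a vertex nor an edge); the infinite face is the one containing the
   root, and it has to contain all half-edges. *)
definition planar_map :: "rooted_map \<Rightarrow> bool" where
  "planar_map M \<longleftrightarrow>
     finite (darts M) \<and>
     rot M permutes darts M \<and>
     opp M permutes darts M \<and>
     (\<forall>d\<in>darts M. opp M (opp M d) = d) \<and>
     (\<forall>d\<in>darts M. white M (rot M d) = white M d) \<and>
     (\<forall>d\<in>darts M. opp M d \<noteq> d \<longrightarrow> white M (opp M d) \<noteq> white M d) \<and>
     root_dart M \<in> half_edges M \<and>
     darts M \<subseteq> reachable (rot M) (opp M) (root_dart M) \<and>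
     card (vertices M) + card (faces M) = card (edges M) + 2 \<and>
     half_edges M \<subseteq> orbit (contour M) (root_dart M)"

(* Orientation-preserving homeomorphism of rooted maps. *)
definition isomorphic :: "rooted_map \<Rightarrow> rooted_map \<Rightarrow> bool" where
  "isomorphic M N \<longleftrightarrow>
     (\<exists>h. bij_betw h (darts M) (darts N) \<and>
          (\<forall>d\<in>darts M. h (rot M d) = rot N (h d) \<and> h (opp M d) = opp N (h d) \<and>
                       white N (h d) = white M d) \<and>
          h (root_dart M) = root_dart N)"

definition map_iso :: "(rooted_map \<times> rooted_map) set" where
  "map_iso = {(M, N). planar_map M \<and> planar_map N \<and> isomorphic M N}"

definition degree_distribution :: "rooted_map \<Rightarrow> nat multiset \<times> nat multiset" where
  "degree_distribution M =
     (image_mset card (mset_set {v \<in> vertices M. \<forall>d\<in>v. white M d}),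
      image_mset card (mset_set {v \<in> vertices M. \<forall>d\<in>v. \<not> white M d}))"

definition leg_map :: "nat \<Rightarrow> rooted_map \<Rightarrow> bool" where
  "leg_map k M \<longleftrightarrow>
     planar_map M \<and> card (leaves M) = k \<and> buds M = {} \<and> root_dart M \<in> leaves M"

definition tree :: "rooted_map \<Rightarrow> bool" where
  "tree T \<longleftrightarrow> planar_map T \<and> card (faces T) = 1"

definition charge :: "rooted_map \<Rightarrow> int" where
  "charge T = int (card (leaves T - {root_dart T})) - int (card (buds T - {root_dart T}))"

definition total_charge :: "rooted_map \<Rightarrow> int" where
  "total_charge T = int (card (leaves T)) - int (card (buds T))"

(* Cuts the edge {d, opp T d} and keeps the component of d, rooted at d.  As colours are kept, the
   new half-edge is a leaf if d is white and a bud if d is black. *)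
definition cut :: "rooted_map \<Rightarrow> nat \<Rightarrow> rooted_map" where
  "cut T d =
     (let a = (opp T)(d := d, opp T d := opp T d);
          D = reachable (rot T) a d
      in \<lparr>darts = D, rot = perm_restrict (rot T) D, opp = perm_restrict a D,
          white = white T, root_dart = d\<rparr>)"

definition blossom_tree :: "rooted_map \<Rightarrow> bool" where
  "blossom_tree T \<longleftrightarrow> tree T \<and>
     (\<forall>d\<in>darts T. opp T d \<noteq> d \<and> root_dart T \<notin> darts (cut T d) \<longrightarrow>
        (if white T d then 0 \<le> charge (cut T d) else charge (cut T d) \<le> 1))"

(* l is the first element of R met after b on the cyclic contour walk. *)
definition next_in :: "rooted_map \<Rightarrow> nat set \<Rightarrow> nat \<Rightarrow> nat \<Rightarrow> bool" where
  "next_in T R b l \<longleftrightarrow>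
     l \<in> R \<and> (\<exists>n>0. (contour T ^^ n) b = l \<and> (\<forall>m. 0 < m \<and> m < n \<longrightarrow> (contour T ^^ m) b \<notin> R))"

definition matchable :: "rooted_map \<Rightarrow> nat set \<Rightarrow> nat \<Rightarrow> nat \<Rightarrow> bool" where
  "matchable T R b l \<longleftrightarrow> b \<in> R \<inter> buds T \<and> l \<in> R \<inter> leaves T \<and> next_in T R b l"

(* The possible sets of still unmatched half-edges in the course of the matching procedure. *)
inductive unmatched :: "rooted_map \<Rightarrow> nat set \<Rightarrow> bool" for T where
  start: "unmatched T (half_edges T)"
| step: "unmatched T R \<Longrightarrow> matchable T R b l \<Longrightarrow> unmatched T (R - {b, l})"

(* The final set R does not depend on the order in which pairs are matched. *)
definition single :: "rooted_map \<Rightarrow> nat \<Rightarrow> bool" where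
  "single T l \<longleftrightarrow> l \<in> leaves T \<and>
     (\<exists>R. unmatched T R \<and> (\<nexists>b l'. matchable T R b l') \<and> l \<in> R)"

definition balanced :: "rooted_map \<Rightarrow> bool" where
  "balanced T \<longleftrightarrow> tree T \<and> single T (root_dart T)"

definition balanced_blossom_trees :: "int \<Rightarrow> rooted_map set" where
  "balanced_blossom_trees k = {T. blossom_tree T \<and> balanced T \<and> total_charge T = k}"

definition leg_maps :: "nat \<Rightarrow> rooted_map set" where
  "leg_maps k = {M. leg_map k M}"

lemma isomorphic_refl: "isomorphic M M"
  unfolding isomorphic_def by (intro exI[of _ id]) auto

lemma isomorphic_sym:
  assumes M: "planar_map M" and iso: "isomorphic M N"
  shows "isomorphic N M"
proof -
  from iso obtain h where h: "bij_betw h (darts M) (darts N)"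
    and hom: "\<And>d. d \<in> darts M \<Longrightarrow> h (rot M d) = rot N (h d) \<and> h (opp M d) = opp N (h d) \<and>
                white N (h d) = white M d"
    and r: "h (root_dart M) = root_dart N"
    unfolding isomorphic_def by blast
  define g where "g = inv_into (darts M) h"
  have g: "bij_betw g (darts N) (darts M)"
    unfolding g_def by (rule bij_betw_inv_into[OF h])
  have gh: "g (h d) = d" if "d \<in> darts M" for d
    using that h unfolding g_def by (simp add: bij_betw_inv_into_left)
  have closed: "rot M d \<in> darts M" "opp M d \<in> darts M" if "d \<in> darts M" for d
    using M that by (auto simp: planar_map_def permutes_in_image)
  have "g (rot N e) = rot M (g e) \<and> g (opp N e) = opp M (g e) \<and> white M (g e) = white N e"
    if e: "e \<in> darts N" for e
  proof -
    obtain d where d: "d \<in> darts M" "e = h d"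
      using e h unfolding bij_betw_def by blast
    show ?thesis
      using hom[OF d(1)] gh[OF d(1)] gh[OF closed(1)[OF d(1)]] gh[OF closed(2)[OF d(1)]] d(2)
      by metis
  qed
  moreover have "g (root_dart N) = root_dart M"
    using M gh[of "root_dart M"] r by (simp add: planar_map_def half_edges_def)
  ultimately show ?thesis
    unfolding isomorphic_def using g by blast
qed

lemma isomorphic_trans:
  assumes "isomorphic M N" and "isomorphic N P"
  shows "isomorphic M P"
proof -
  from assms obtain h k where
    h: "bij_betw h (darts M) (darts N)" "h (root_dart M) = root_dart N"
      "\<forall>d\<in>darts M. h (rot M d) = rot N (h d) \<and> h (opp M d) = opp N (h d) \<and>
         white N (h d) = white M d" and
    k: "bij_betw k (darts N) (darts P)" "k (root_dart N) = root_dart P"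
      "\<forall>d\<in>darts N. k (rot N d) = rot P (k d) \<and> k (opp N d) = opp P (k d) \<and>
         white P (k d) = white N d"
    unfolding isomorphic_def by blast
  have "h d \<in> darts N" if "d \<in> darts M" for d
    using that h(1) by (auto simp: bij_betw_def)
  then have "\<forall>d\<in>darts M. (k \<circ> h) (rot M d) = rot P ((k \<circ> h) d) \<and>
      (k \<circ> h) (opp M d) = opp P ((k \<circ> h) d) \<and> white P ((k \<circ> h) d) = white M d"
    using h(3) k(3) by (metis comp_apply)
  moreover have "(k \<circ> h) (root_dart M) = root_dart P"
    using h(2) k(2) by simp
  ultimately show ?thesis
    unfolding isomorphic_def using bij_betw_trans[OF h(1) k(1)] by blast
qed

lemma equiv_map_iso: "equiv {M. planar_map M} map_iso"
proof (rule equivI)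
  show "map_iso \<subseteq> {M. planar_map M} \<times> {M. planar_map M}"
    by (auto simp: map_iso_def)
  show "refl_on {M. planar_map M} map_iso"
    by (auto simp: map_iso_def refl_on_def isomorphic_refl)
  show "sym map_iso"
    using isomorphic_sym by (auto simp: map_iso_def sym_def)
  show "trans map_iso"
    unfolding trans_def map_iso_def using isomorphic_trans by blast
qed

end

theory Submission
  imports Defs "HOL-Library.Confluence"
begin

text \<open>Closing and opening change only the involution \<open>opp\<close>, so vertices and degrees are kept for free.
  Glueing a bud to the next half-edge, if it is a leaf other than the root, splits the outer face;
  the inverse step detaches an edge met from its black end on the outer face with another face
  behind it.  Glueing steps commute, hence the closure is unique.

  Walk around the outer face from the root and let the height of a dart be the number of buds minus
  the number of leaves passed before (the root not counted).  In a tree the lower subtree at an edge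
  is the part of the walk between its two sides, so its charge is a height difference, and the
  blossom condition says: for every edge with black side \<open>b\<close> and white side \<open>w\<close>, the height of \<open>w\<close>
  exceeds that of \<open>b\<close> by at most \<open>1\<close>, and not at all if \<open>b\<close> comes first.  Detaching always the
  lexicographically least edge (height of the black side, then position) preserves this condition on
  the outer face.  It holds at the start because with two legs the heights are \<open>0\<close> and then \<open>-1\<close>.
  Conversely, if the least edge of some stage were an edge of a blossom tree reached later, its
  white side would be uncovered too high, violating the condition; so every opening to a blossom
  tree is the greedy one.\<close>

section \<open>Cycles of a permutation as lists, joined and split by transpositions\<close>

section \<open>Cyclic lists\<close>

text \<open>Steps keep the labels of all darts, so closures and openings are compared by equality of
  records. Isomorphisms enter only at the end, where one relabelling is carried along a whole
  sequence of steps, and the relation \<open>closes\<^sup>*\<^sup>*\<close> then descends to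
  classes.

  The obstacle on the way back is that the two sides of an edge may reach the outer face at
  different times. Detaching at \<open>b\<close> uncovers an entire face, with every dart of it one
  level above \<open>b\<close>. If an uncovered white side belongs to a black side that is already
  outer, that black side comes lexicographically after \<open>b\<close>, and this is just what the
  two clauses of the blossom condition ask for. If instead the white side is old and the black side
  new, minimality says nothing; a separate invariant is required, namely that no outer dart lies
  more than one level above the black side of an edge still to be opened. The heights 0 and -1 of a
  map with two legs satisfy it at the start.\<close>

definition cyc :: "('a \<Rightarrow> 'a) \<Rightarrow> 'a list \<Rightarrow> bool" where
  "cyc c ys \<longleftrightarrow> ys \<noteq> [] \<and> distinct ys \<and> map c ys = rotate1 ys"

lemma cyc_nth:
  assumes "cyc c ys" "i < length ys"
  shows "c (ys ! i) = ys ! (Suc i mod length ys)"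
  using assms nth_rotate1[of i ys] nth_map[of i ys c] by (simp add: cyc_def)

lemma cyc_funpow:
  assumes "cyc c ys" "i < length ys"
  shows "(c ^^ n) (ys ! i) = ys ! ((i + n) mod length ys)"
proof (induction n)
  case (Suc n)
  then show ?case
    using assms cyc_nth[OF assms(1), of "(i + n) mod length ys"] by (simp add: cyc_def mod_Suc_eq)
qed (use assms in simp)

lemma cyc_orbit:
  assumes "cyc c ys" "x \<in> set ys"
  shows "orbit c x = set ys"
proof -
  obtain i where i: "i < length ys" "x = ys ! i"
    using assms(2) by (auto simp: in_set_conv_nth)
  have "ys ! j \<in> orbit c x" if "j < length ys" for j
  proof -
    have "(i + (length ys + j - i)) mod length ys = j" "length ys + j - i > 0"
      using that i by auto
    then show ?thesis
      unfolding orbit_altdef using cyc_funpow[OF assms(1) i(1)] i(2) by (metis (mono_tags, lifting) mem_Collect_eq)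
  qed
  moreover have "(c ^^ n) x \<in> set ys" for n
    using cyc_funpow[OF assms(1) i(1)] i by (simp add: assms(1)[unfolded cyc_def])
  ultimately show ?thesis
    by (auto simp: orbit_altdef in_set_conv_nth)
qed

lemma cyc_mem:
  assumes "cyc c ys" "x \<in> set ys" shows "c x \<in> set ys"
  using assms orbit.base[of c x] by (simp add: cyc_orbit)

lemma cyc_unique:
  assumes "cyc c xs" "cyc c ys" "hd xs = hd ys"
  shows "xs = ys"
proof (rule nth_equalityI)
  have ne: "xs \<noteq> []" "ys \<noteq> []"
    using assms by (auto simp: cyc_def)
  then have "hd xs \<in> set xs" "hd ys \<in> set ys"
    by auto
  then have "set xs = set ys"
    using cyc_orbit[OF assms(1), of "hd xs"] cyc_orbit[OF assms(2), of "hd ys"] assms(3) by simp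
  then show len: "length xs = length ys"
    using assms(1,2) by (metis cyc_def distinct_card)
  show "xs ! i = ys ! i" if "i < length xs" for i
    using cyc_funpow[OF assms(1), of 0 i] cyc_funpow[OF assms(2), of 0 i] that ne len assms(3)
    by (simp add: hd_conv_nth)
qed

lemma cyc_exists:
  assumes "c permutes D" "finite D"
  obtains ys where "cyc c ys" "hd ys = x"
proof -
  have "permutation c"
    using assms permutation_permutes by blast
  then have "x \<in> orbit c x"
    by (rule permutation_self_in_orbit)
  define n where "n = funpow_dist1 c x x"
  define ys where "ys = map (\<lambda>i. (c ^^ i) x) [0..<n]"
  have n: "0 < n" "(c ^^ n) x = x"
    using funpow_dist1_prop[OF \<open>x \<in> orbit c x\<close>] by (auto simp: n_def)
  have inj: "inj_on (\<lambda>i. (c ^^ i) x) {0..<n}"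
    unfolding n_def by (rule inj_on_funpow_dist1) (use \<open>x \<in> orbit c x\<close> in auto)
  have "map c ys = rotate1 ys"
  proof (rule nth_equalityI)
    fix i assume "i < length (map c ys)"
    then have i: "i < n" by (simp add: ys_def)
    show "map c ys ! i = rotate1 ys ! i"
    proof (cases "Suc i = n")
      case True
      then show ?thesis
        using i n nth_rotate1[of i ys] by (auto simp: ys_def)
    next
      case False
      then show ?thesis
        using i n nth_rotate1[of i ys] by (auto simp: ys_def)
    qed
  qed simp
  moreover have "ys \<noteq> []" "distinct ys" "hd ys = x"
    using n inj by (auto simp: ys_def distinct_map hd_map)
  ultimately show ?thesis
    using that by (auto simp: cyc_def)
qed

text \<open>Comparing prefixes of equal length separates the rotation equation into one for
  \<open>A\<close> and one for the rest, so both can be edited independently. Putting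
  \<open>A @ [b]\<close> under \<open>tl\<close> and \<open>hd\<close> covers the empty
  \<open>A\<close> as well.\<close>

lemma cyc_append_Cons:
  "cyc c (A @ b # C) \<longleftrightarrow> distinct (A @ b # C) \<and> map c A = tl (A @ [b]) \<and>
     c b # map c C = C @ [hd (A @ [b])]"
proof (cases A)
  case (Cons a A')
  have "c a # map c A' @ c b # map c C = A' @ b # C @ [a] \<longleftrightarrow>
      (c a # map c A') @ (c b # map c C) = (A' @ [b]) @ (C @ [a])"
    by simp
  also have "\<dots> \<longleftrightarrow> c a # map c A' = A' @ [b] \<and> c b # map c C = C @ [a]"
    by (rule append_eq_append_conv) simp
  finally show ?thesis
    using Cons by (simp add: cyc_def)
qed (auto simp: cyc_def)

text \<open>Exchanging the images of two points on different cycles joins the cycles: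
  \<open>b\<close> now leads into \<open>F\<close>, and \<open>w\<close> leads to where
  \<open>b\<close> led before. The next lemma is the same exchange inside one cycle.\<close>

lemma cyc_merge:
  assumes "cyc c (A @ b # C)" "cyc c (F @ [w])" "set (A @ b # C) \<inter> set (F @ [w]) = {}"
    and "c' b = c w" "c' w = c b" "\<And>x. x \<noteq> b \<Longrightarrow> x \<noteq> w \<Longrightarrow> c' x = c x"
  shows "cyc c' (A @ b # F @ w # C)"
proof -
  have *: "map c' X = map c X" if "b \<notin> set X" "w \<notin> set X" for X
    using that by (intro map_cong refl assms(6)) auto
  have 1: "distinct (A @ b # C)" "map c A = tl (A @ [b])" "c b # map c C = C @ [hd (A @ [b])]"
    using assms(1) unfolding cyc_append_Cons by auto
  have 2: "distinct (F @ [w])" "map c F = tl (F @ [w])" "c w = hd (F @ [w])"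
    using assms(2) unfolding cyc_append_Cons by auto
  have "c w # map c F = F @ [w]"
    using 2 by (metis hd_Cons_tl snoc_eq_iff_butlast)
  moreover have "map c' A = map c A" "map c' F = map c F" "map c' C = map c C"
    using 1(1) 2(1) assms(3) by (auto intro!: * simp del: map_eq_conv)
  ultimately show ?thesis
    unfolding cyc_append_Cons using 1 2 assms(3-5) by (auto simp del: map_eq_conv)
qed

lemma cyc_split:
  assumes "cyc c (A @ b # F @ w # C)"
    and "c' b = c w" "c' w = c b" "\<And>x. x \<noteq> b \<Longrightarrow> x \<noteq> w \<Longrightarrow> c' x = c x"
  shows "cyc c' (A @ b # C)" "cyc c' (F @ [w])"
proof -
  have *: "map c' X = map c X" if "b \<notin> set X" "w \<notin> set X" for X
    using that by (intro map_cong refl assms(4)) auto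
  have 1: "distinct (A @ b # F @ w # C)" "map c A = tl (A @ [b])"
      "c b # map c F @ c w # map c C = (F @ [w]) @ (C @ [hd (A @ [b])])"
    using assms(1) unfolding cyc_append_Cons by auto
  have 2: "c b # map c F = F @ [w]" "c w # map c C = C @ [hd (A @ [b])]"
    using 1(3) append_eq_append_conv[of "c b # map c F" "F @ [w]" "c w # map c C"] by auto
  have 3: "map c' A = map c A" "map c' F = map c F" "map c' C = map c C"
    using 1(1) by (auto intro!: * simp del: map_eq_conv)
  then show "cyc c' (A @ b # C)"
    unfolding cyc_append_Cons using 1 2 assms(2) by (auto simp del: map_eq_conv)
  show "cyc c' (F @ [w])"
    unfolding cyc_append_Cons using 1 2 3 assms(3) by (cases F) (auto simp del: map_eq_conv)
qed

lemma cyc_map: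
  assumes "cyc c ys" "inj_on h (set ys)" "\<And>x. x \<in> set ys \<Longrightarrow> h (c x) = c' (h x)"
  shows "cyc c' (map h ys)"
proof -
  have "map c' (map h ys) = map h (map c ys)"
    using assms(3) by simp
  then show ?thesis
    using assms by (simp add: cyc_def distinct_map rotate1_map del: map_map)
qed

text \<open>Since the cyclic list starts in \<open>R\<close>, a walk from \<open>b\<close> to the first element of \<open>R\<close> does not
  wrap around unless it ends at the head.\<close>

lemma cyc_first_hit:
  assumes "cyc c xs" "hd xs \<in> R" "b \<in> set xs" "l \<noteq> hd xs"
  shows "(l \<in> R \<and> (\<exists>n>0. (c ^^ n) b = l \<and> (\<forall>m. 0 < m \<and> m < n \<longrightarrow> (c ^^ m) b \<notin> R))) \<longleftrightarrow>
    (\<exists>A F C. xs = A @ b # F @ l # C \<and> set F \<inter> R = {} \<and> l \<in> R)"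
proof (intro iffI)
  obtain A B where xs: "xs = A @ b # B"
    using split_list[OF assms(3)] by blast
  have pow: "(c ^^ n) b = xs ! ((length A + n) mod length xs)" for n
    using cyc_funpow[OF assms(1), of "length A" n] xs by simp
  have powB: "(c ^^ Suc i) b = B ! i" if "i < length B" for i
    using pow[of "Suc i"] that xs by (auto simp: nth_append)
  have powhd: "(c ^^ Suc (length B)) b = hd xs"
    using pow[of "Suc (length B)"] xs by (simp add: hd_conv_nth)
  {
    assume "l \<in> R \<and> (\<exists>n>0. (c ^^ n) b = l \<and> (\<forall>m. 0 < m \<and> m < n \<longrightarrow> (c ^^ m) b \<notin> R))"
    then obtain n where n: "l \<in> R" "n > 0" "(c ^^ n) b = l"
      "\<And>m. 0 < m \<Longrightarrow> m < n \<Longrightarrow> (c ^^ m) b \<notin> R" by blast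
    have "n \<le> length B"
    proof (rule ccontr)
      assume "\<not> n \<le> length B"
      then show False
        using n(2-4) n(4)[of "Suc (length B)"] powhd assms(2,4)
        by (metis Suc_leI linorder_neqE_nat not_less zero_less_Suc)
    qed
    then have l: "l = B ! (n - 1)" "n - 1 < length B"
      using powB[of "n - 1"] n by auto
    have B: "B = take (n - 1) B @ l # drop n B"
      using id_take_nth_drop[OF l(2)] l(1) n(2) by simp
    have "B ! i \<notin> R" if "i < n - 1" for i
      using n(4)[of "Suc i"] powB[of i] that l(2) by simp
    then have "set (take (n - 1) B) \<inter> R = {}"
      using l(2) by (auto simp: in_set_conv_nth)
    then show "\<exists>A F C. xs = A @ b # F @ l # C \<and> set F \<inter> R = {} \<and> l \<in> R"
      using xs B n(1) by metis
  }
  assume "\<exists>A F C. xs = A @ b # F @ l # C \<and> set F \<inter> R = {} \<and> l \<in> R"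
  then obtain A' F C where F: "xs = A' @ b # F @ l # C" "set F \<inter> R = {}" "l \<in> R" by blast
  have "B = F @ l # C"
    using F(1) xs assms(1) by (auto simp: cyc_def append_eq_append_conv2 Cons_eq_append_conv append_eq_Cons_conv)
  have "(c ^^ Suc (length F)) b = l"
    using powB[of "length F"] \<open>B = _\<close> by simp
  moreover have "(c ^^ m) b \<notin> R" if "0 < m" "m < Suc (length F)" for m
  proof -
    have "(c ^^ m) b = F ! (m - 1)" "m - 1 < length F"
      using powB[of "m - 1"] that \<open>B = _\<close> by (auto simp: nth_append)
    then show ?thesis
      using F(2) by (auto dest: nth_mem)
  qed
  ultimately show "l \<in> R \<and> (\<exists>n>0. (c ^^ n) b = l \<and> (\<forall>m. 0 < m \<and> m < n \<longrightarrow> (c ^^ m) b \<notin> R))"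
    using F(3) zero_less_Suc by blast
qed

section \<open>Cutting or joining one edge: faces, connectivity and Euler's formula\<close>

section \<open>Detaching and glueing\<close>

text \<open>Fixing the root as head turns the cyclic walk into a linear order, in which prefix sums
  and positions make sense and a bud followed by a leaf never straddles the root.\<close>

definition outer :: "rooted_map \<Rightarrow> nat list \<Rightarrow> bool" where
  "outer P ys \<longleftrightarrow> cyc (contour P) ys \<and> hd ys = root_dart P"

definition detach :: "rooted_map \<Rightarrow> nat \<Rightarrow> rooted_map" where
  "detach P b = P\<lparr>opp := (opp P)(b := b, opp P b := opp P b)\<rparr>"

definition glue :: "rooted_map \<Rightarrow> nat \<Rightarrow> nat \<Rightarrow> rooted_map" where
  "glue P b l = P\<lparr>opp := (opp P)(b := l, l := b)\<rparr>"

lemma detach_simps [simp]: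
  "darts (detach P b) = darts P" "rot (detach P b) = rot P" "white (detach P b) = white P"
  "root_dart (detach P b) = root_dart P"
  "opp (detach P b) = (opp P)(b := b, opp P b := opp P b)"
  by (simp_all add: detach_def)

lemma glue_simps [simp]:
  "darts (glue P b l) = darts P" "rot (glue P b l) = rot P" "white (glue P b l) = white P"
  "root_dart (glue P b l) = root_dart P"
  "opp (glue P b l) = (opp P)(b := l, l := b)"
  by (simp_all add: glue_def)

lemma planar_mapD:
  assumes "planar_map P"
  shows "finite (darts P)" "rot P permutes darts P" "opp P permutes darts P"
    "contour P permutes darts P" "root_dart P \<in> darts P" "opp P (root_dart P) = root_dart P"
    "\<And>d. opp P (opp P d) = d"
    "\<And>d. d \<in> darts P \<Longrightarrow> white P (rot P d) = white P d"
    "\<And>d. d \<in> darts P \<Longrightarrow> opp P d \<noteq> d \<Longrightarrow> white P (opp P d) \<noteq> white P d"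
    "\<And>d. opp P d \<noteq> d \<Longrightarrow> d \<in> darts P"
    "\<And>d. d \<in> darts P \<Longrightarrow> rot P d \<in> darts P"
    "\<And>d. d \<in> darts P \<Longrightarrow> opp P d \<in> darts P"
    "darts P \<subseteq> reachable (rot P) (opp P) (root_dart P)"
    "half_edges P \<subseteq> orbit (contour P) (root_dart P)"
proof -
  have *: "rot P permutes darts P" "opp P permutes darts P" "\<forall>d\<in>darts P. opp P (opp P d) = d"
    using assms by (auto simp: planar_map_def)
  then have "(rot P \<circ> opp P) permutes darts P"
    using permutes_compose by blast
  then show "contour P permutes darts P"
    by (simp add: contour_def[abs_def] comp_def)
  show "\<And>d. opp P (opp P d) = d"
    using * by (metis permutes_not_in)
  show "\<And>d. opp P d \<noteq> d \<Longrightarrow> d \<in> darts P"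
    using * by (metis permutes_not_in)
  show "\<And>d. d \<in> darts P \<Longrightarrow> rot P d \<in> darts P" "\<And>d. d \<in> darts P \<Longrightarrow> opp P d \<in> darts P"
    using * by (auto simp: permutes_in_image)
qed (use assms in \<open>auto simp: planar_map_def half_edges_def\<close>)

lemma outer_exists:
  assumes "planar_map P"
  obtains ys where "outer P ys"
  using cyc_exists[OF planar_mapD(4,1)[OF assms]] unfolding outer_def by metis

lemma outer_root:
  assumes "outer P ys" shows "root_dart P \<in> set ys" "ys \<noteq> []"
  using assms by (auto simp: outer_def cyc_def) (metis hd_in_set)

lemma outer_orbit:
  assumes "outer P ys" shows "orbit (contour P) (root_dart P) = set ys"
  using assms outer_root[OF assms] by (auto simp: outer_def cyc_orbit)

lemma outer_orbit_mem:
  assumes "outer P ys" "x \<in> set ys" shows "orbit (contour P) x = set ys"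
  using assms cyc_orbit unfolding outer_def by metis

lemma outer_unique:
  assumes "outer P xs" "outer P ys" shows "xs = ys"
  using assms cyc_unique unfolding outer_def by metis

lemma outer_distinct:
  assumes "outer P ys" shows "distinct ys"
  using assms by (simp add: outer_def cyc_def)

lemma outer_darts:
  assumes "planar_map P" "outer P ys" shows "set ys \<subseteq> darts P"
  using permutes_orbit_subset[OF planar_mapD(4,5)[OF assms(1)]] outer_orbit[OF assms(2)] by simp

lemma outer_half_edges:
  assumes "planar_map P" "outer P ys" shows "half_edges P \<subseteq> set ys"
  using planar_mapD(14)[OF assms(1)] outer_orbit[OF assms(2)] by simp

lemma image_eq_singleton: "X \<noteq> {} \<Longrightarrow> (\<And>x. x \<in> X \<Longrightarrow> f x = k) \<Longrightarrow> f ` X = {k}"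
  by auto

lemma orbit_reachable:
  assumes "y \<in> orbit (\<lambda>d. s (a d)) x" shows "y \<in> reachable s a x"
proof -
  let ?r = "\<lambda>x y. y = s x \<or> y = a x"
  have *: "?r\<^sup>*\<^sup>* x (s (a x))" for x
  proof -
    have 1: "?r x (a x)" and 2: "?r (a x) (s (a x))" by simp_all
    show ?thesis
      by (rule rtranclp.rtrancl_into_rtrancl[of ?r x "a x", OF r_into_rtranclp[of ?r, OF 1] 2])
  qed
  from assms have "?r\<^sup>*\<^sup>* x y"
  proof induction
    case (step y)
    show ?case by (rule rtranclp_trans[of ?r, OF step.IH *])
  qed (rule *)
  then show ?thesis by (simp add: reachable_def)
qed

lemma card_edges_cut:
  assumes "finite D" "b \<in> D" "b \<noteq> l" "f b = l" "f l = b" "g b = b" "g l = l"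
    and other: "\<And>x. x \<noteq> b \<Longrightarrow> x \<noteq> l \<Longrightarrow> g x = f x"
  shows "card {{d, f d} | d. d \<in> D \<and> f d \<noteq> d} = card {{d, g d} | d. d \<in> D \<and> g d \<noteq> d} + 1"
    (is "card ?E = card ?E' + 1")
proof -
  have "{d, f d} \<in> insert {b, l} ?E'" if "d \<in> D" "f d \<noteq> d" for d
  proof (cases "d = b \<or> d = l")
    case False
    then have "g d = f d" using other by blast
    then show ?thesis using that by (intro insertI2) force
  qed (use assms in \<open>auto simp: insert_commute\<close>)
  moreover have "{d, g d} \<in> ?E" if "d \<in> D" "g d \<noteq> d" for d
  proof (cases "d = b \<or> d = l")
    case False
    then have "g d = f d" using other by blast
    then show ?thesis using that by force
  qed (use that assms in auto)
  moreover have "{b, l} \<in> ?E"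
    using assms by force
  ultimately have "?E = insert {b, l} ?E'"
    by blast
  moreover have "{b, l} \<notin> ?E'"
  proof
    assume "{b, l} \<in> ?E'"
    then obtain d where d: "{b, l} = {d, g d}" "g d \<noteq> d" by blast
    from d(1) have "d = b \<or> d = l" by blast
    then show False using d(2) assms by metis
  qed
  moreover have "finite ?E'"
  proof -
    have "?E' \<subseteq> (\<lambda>d. {d, g d}) ` D" by auto
    then show ?thesis using assms(1) finite_surj by blast
  qed
  ultimately show ?thesis by simp
qed

text \<open>One step seen from both ends: \<open>P\<close> has the edge between \<open>b\<close> and
  \<open>l\<close>, and in \<open>P'\<close> the edge is cut. \<open>F @ [l]\<close> is the face of
  \<open>P\<close> behind the edge, and a nonempty \<open>A\<close> keeps the root in front of
  \<open>b\<close>. Planarity is assumed on neither side because it has to be carried over in both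
  directions.\<close>

locale surgery =
  fixes P P' :: rooted_map and A F C :: "nat list" and b l :: nat
  assumes same: "darts P' = darts P" "rot P' = rot P" "white P' = white P" "root_dart P' = root_dart P"
    and oppP: "opp P b = l" "opp P l = b"
    and oppP': "opp P' b = b" "opp P' l = l"
    and opp_other: "\<And>x. x \<noteq> b \<Longrightarrow> x \<noteq> l \<Longrightarrow> opp P' x = opp P x"
    and color: "\<not> white P b" "white P l"
    and outP: "outer P (A @ b # C)" and inner: "cyc (contour P) (F @ [l])"
    and disj: "set (A @ b # C) \<inter> set (F @ [l]) = {}"
    and root_b: "A \<noteq> []"
begin

lemma neq: "b \<noteq> l" "root_dart P \<noteq> b" "root_dart P \<noteq> l"
proof -
  have "root_dart P = hd A" "distinct (A @ b # C)"
    using outP root_b by (auto simp: outer_def cyc_def)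
  then have "root_dart P \<in> set A"
    using root_b by simp
  then show "b \<noteq> l" "root_dart P \<noteq> b" "root_dart P \<noteq> l"
    using \<open>distinct (A @ b # C)\<close> disj by auto
qed

text \<open>In \<open>P\<close> the step from \<open>l\<close> crosses to \<open>b\<close> and then
  rotates; once \<open>b\<close> is a half-edge, the step from \<open>b\<close> rotates at once. So
  cutting an edge exchanges the contour images of its two sides, which is the situation of
  \<open>cyc_merge\<close>.\<close>

lemma contour_P': "contour P' b = contour P l" "contour P' l = contour P b"
  "\<And>x. x \<noteq> b \<Longrightarrow> x \<noteq> l \<Longrightarrow> contour P' x = contour P x"
  using same oppP oppP' opp_other by (auto simp: contour_def)

lemma outP': "outer P' (A @ b # F @ l # C)"
  using cyc_merge[OF _ inner disj contour_P'] outP root_b same by (auto simp: outer_def)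

lemma half_edges_P': "b \<in> darts P \<Longrightarrow> l \<in> darts P \<Longrightarrow> half_edges P' = {b, l} \<union> half_edges P"
  "half_edges P = half_edges P' - {b, l}"
  using same oppP oppP' opp_other neq by (auto simp: half_edges_def) metis+

lemma opp_eq: "opp P' = opp P \<circ> transpose b l" "opp P = opp P' \<circ> transpose b l"
  using oppP oppP' opp_other by (auto simp: fun_eq_iff transpose_def)

text \<open>The two faces of \<open>P\<close> along the edge become the single face \<open>S\<close>
  of \<open>P'\<close>, and all other orbits avoid \<open>S\<close>, where the contours agree. Faces
  and edges thus change by the same amount, and Euler's formula survives in either
  direction.\<close>

lemma counts:
  assumes "contour P permutes darts P" "finite (darts P)" "b \<in> darts P" "l \<in> darts P"
    "\<And>d. opp P (opp P d) = d"
  shows "card (faces P) = card (faces P') + 1" "card (edges P) = card (edges P') + 1"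
    "vertices P = vertices P'"
proof -
  let ?c = "contour P" and ?D = "darts P"
  define S where "S = set (A @ b # F @ l # C)"
  have S: "S = set (A @ b # C) \<union> set (F @ [l])"
    by (auto simp: S_def)
  have orbs: "orbit ?c x = set (A @ b # C)" if "x \<in> set (A @ b # C)" for x
    by (rule outer_orbit_mem[OF outP that])
  have orbs': "orbit ?c x = set (F @ [l])" if "x \<in> set (F @ [l])" for x
    by (rule cyc_orbit[OF inner that])
  have inj: "inj ?c"
    using assms(1) permutes_inj by blast
  have "?c ` S \<subseteq> S"
    using cyc_mem[OF inner] cyc_mem[of ?c "A @ b # C"] outP unfolding S outer_def by blast
  then have cS: "?c ` S = S"
    by (intro endo_inj_surj inj_on_subset[OF inj]) (auto simp: S_def)
  have out: "?c x \<in> - S" if "x \<in> - S" for x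
    using that cS inj by (metis ComplD ComplI imageE injD)
  have sub: "orbit ?c x \<subseteq> - S" if "x \<in> - S" for x
  proof
    fix y assume "y \<in> orbit ?c x"
    then show "y \<in> - S" by induction (use that out in auto)
  qed
  have eq: "orbit (contour P') x = orbit ?c x" if "x \<in> - S" for x
  proof (rule sym, rule orbit_cong0[OF that])
    show "?c \<in> - S \<rightarrow> - S" using out by auto
    show "?c y = contour P' y" if "y \<in> - S" for y
      using contour_P'(3)[of y] that by (auto simp: S_def)
  qed
  \<comment> \<open>Each orbit inside \<open>S\<close> contains \<open>b\<close> or
    \<open>l\<close>, and a permutation of \<open>?D\<close> enters \<open>?D\<close> only from
    \<open>?D\<close>, so membership can be traced backwards along the orbit.\<close>
  have SD: "S \<subseteq> ?D"
  proof -
    have "x \<in> ?D" if "x \<in> S" for x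
    proof -
      have "b \<in> orbit ?c x \<or> l \<in> orbit ?c x"
        using that orbs[of x] orbs'[of x] by (auto simp: S)
      moreover have "x \<in> ?D" if "y \<in> orbit ?c x" "y \<in> ?D" for y
        using that by induction (use assms(1) in \<open>auto simp: permutes_in_image\<close>)
      ultimately show ?thesis using assms(3,4) by blast
    qed
    then show ?thesis by blast
  qed
  define R where "R = orbit ?c ` (?D - S)"
  have "faces P = orbit ?c ` S \<union> R"
    using SD unfolding faces_def R_def by blast
  moreover have "orbit ?c ` S = {set (A @ b # C), set (F @ [l])}"
  proof -
    have 1: "orbit ?c ` set (A @ b # C) = {set (A @ b # C)}"
      by (rule image_eq_singleton, simp, rule orbs)
    have 2: "orbit ?c ` set (F @ [l]) = {set (F @ [l])}"
      by (rule image_eq_singleton, simp, rule orbs')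
    show ?thesis
      unfolding S image_Un 1 2 by (rule insert_is_Un[symmetric])
  qed
  ultimately have fP: "faces P = insert (set (A @ b # C)) (insert (set (F @ [l])) R)"
    by (simp only: insert_is_Un[symmetric] Un_insert_left Un_empty_left)
  have "orbit (contour P') ` S = {S}"
    unfolding S_def by (rule image_eq_singleton, simp, rule outer_orbit_mem[OF outP'])
  moreover have "orbit (contour P') ` (?D - S) = R"
    unfolding R_def by (rule image_cong) (auto intro!: eq)
  moreover have "faces P' = orbit (contour P') ` S \<union> orbit (contour P') ` (?D - S)"
    using SD unfolding faces_def same by blast
  ultimately have fP': "faces P' = insert S R"
    by simp
  have "finite R" using assms(2) by (simp add: R_def)
  have R: "X \<inter> S = {}" if "X \<in> R" for X
    using that sub by (auto simp: R_def)
  have "S \<notin> R" "set (A @ b # C) \<notin> R" "set (F @ [l]) \<notin> R" "set (A @ b # C) \<noteq> set (F @ [l])"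
  proof -
    have "b \<in> set (A @ b # C)" "l \<in> set (F @ [l])" "b \<in> S" "l \<in> S" "b \<notin> set (F @ [l])"
      using disj by (auto simp: S)
    then show "S \<notin> R" "set (A @ b # C) \<notin> R" "set (F @ [l]) \<notin> R" "set (A @ b # C) \<noteq> set (F @ [l])"
      using R[of S] R[of "set (A @ b # C)"] R[of "set (F @ [l])"] by (metis IntI emptyE)+
  qed
  then show "card (faces P) = card (faces P') + 1"
    using \<open>finite R\<close> unfolding fP fP' by simp
  show "card (edges P) = card (edges P') + 1"
    unfolding edges_def same
    by (rule card_edges_cut[OF assms(2,3) neq(1) oppP oppP' opp_other])
  show "vertices P = vertices P'"
    using same by (simp add: vertices_def)
qed

lemma reachable_P'_P: "reachable (rot P') (opp P') d \<subseteq> reachable (rot P) (opp P) d"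
proof
  fix e assume "e \<in> reachable (rot P') (opp P') d"
  then have "(\<lambda>x y. y = rot P' x \<or> y = opp P' x)\<^sup>*\<^sup>* d e" by (simp add: reachable_def)
  then have "(\<lambda>x y. y = rot P x \<or> y = opp P x)\<^sup>*\<^sup>* d e"
  proof induction
    case (step y z)
    then show ?case
      using oppP' opp_other[of y] same
      by (metis (mono_tags, lifting) rtranclp.rtrancl_into_rtrancl)
  qed simp
  then show "e \<in> reachable (rot P) (opp P) d" by (simp add: reachable_def)
qed

text \<open>The edge that is cut is no bridge: in \<open>P'\<close> both \<open>b\<close> and
  \<open>l\<close> lie on the outer face, and the contour walk around it joins them in both
  directions.\<close>

lemma reachable_P_P':
  "reachable (rot P) (opp P) d \<subseteq> reachable (rot P') (opp P') d"
proof
  let ?r = "\<lambda>x y. y = rot P' x \<or> y = opp P' x"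
  have orb: "?r\<^sup>*\<^sup>* x y" if "y \<in> orbit (contour P') x" for x y
    using orbit_reachable[of y "rot P'" "opp P'" x] that by (simp add: contour_def[abs_def] reachable_def)
  have "orbit (contour P') b = orbit (contour P') l" "l \<in> orbit (contour P') l"
      "b \<in> orbit (contour P') b"
    using outer_orbit_mem[OF outP', of b] outer_orbit_mem[OF outP', of l] by auto
  then have bl: "?r\<^sup>*\<^sup>* b l" "?r\<^sup>*\<^sup>* l b"
    using orb by auto
  fix e assume "e \<in> reachable (rot P) (opp P) d"
  then have "(\<lambda>x y. y = rot P x \<or> y = opp P x)\<^sup>*\<^sup>* d e" by (simp add: reachable_def)
  then have "?r\<^sup>*\<^sup>* d e"
  proof induction
    case (step y z)
    have "?r\<^sup>*\<^sup>* y z"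
    proof (cases "z = rot P y \<or> (y \<noteq> b \<and> y \<noteq> l)")
      case True
      then have "?r y z"
        using opp_other[of y] step.hyps(2) same by auto
      then show ?thesis by blast
    next
      case False
      then have "z = opp P y" "y = b \<or> y = l"
        using step.hyps(2) by auto
      then show ?thesis
        using bl oppP by auto
    qed
    then show ?case using step.IH by simp
  qed simp
  then show "e \<in> reachable (rot P') (opp P') d" by (simp add: reachable_def)
qed

lemma planar_P':
  assumes "planar_map P" shows "planar_map P'"
proof -
  note p = planar_mapD[OF assms]
  have D: "b \<in> darts P" "l \<in> darts P"
    using p(10)[of b] p(10)[of l] oppP neq by auto
  have "opp P' permutes darts P"
    using opp_eq(1) p(3) D permutes_swap_id permutes_compose by metis
  moreover have "opp P' (opp P' d) = d" for d
    using oppP oppP' opp_other p(7)[of d] by metis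
  moreover have "white P' (opp P' d) \<noteq> white P' d" if "d \<in> darts P" "opp P' d \<noteq> d" for d
    using that oppP' opp_other[of d] p(9)[of d] same by metis
  moreover have "root_dart P' \<in> half_edges P'"
    using half_edges_P'(1)[OF D] p(5,6) same by (simp add: half_edges_def)
  moreover have "darts P \<subseteq> reachable (rot P') (opp P') (root_dart P')"
    using p(13) reachable_P_P' same by auto
  moreover have "half_edges P' \<subseteq> orbit (contour P') (root_dart P')"
    using half_edges_P'(1)[OF D] outer_half_edges[OF assms outP] unfolding outer_orbit[OF outP']
    by auto
  moreover have "card (vertices P') + card (faces P') = card (edges P') + 2"
    using counts[OF p(4,1) D p(7)] assms by (simp add: planar_map_def)
  ultimately show ?thesis
    using p same by (simp add: planar_map_def)
qed

text \<open>Joining \<open>b\<close> and \<open>l\<close> turns \<open>F @ [l]\<close> into an inner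
  face. Since half-edges must stay on the outer one, \<open>F\<close> may contain none; this is why
  only consecutive half-edges are glued.\<close>

lemma planar_P:
  assumes "planar_map P'" "set F \<inter> half_edges P' = {}" shows "planar_map P"
proof -
  note p = planar_mapD[OF assms(1)]
  have D: "b \<in> darts P" "l \<in> darts P"
    using outer_darts[OF assms(1) outP'] same by auto
  have 1: "opp P permutes darts P"
    using opp_eq(2) p(3) D permutes_swap_id permutes_compose same by metis
  moreover have 2: "opp P (opp P d) = d" for d
    using oppP oppP' opp_other p(7)[of d] by metis
  moreover have "white P (opp P d) \<noteq> white P d" if "d \<in> darts P" "opp P d \<noteq> d" for d
  proof (cases "d = b \<or> d = l")
    case False
    then show ?thesis
      using that opp_other[of d] p(9)[of d] same by simp
  qed (use oppP color in auto)
  moreover have "root_dart P \<in> half_edges P"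
    using half_edges_P'(2) neq p(5,6) same by (simp add: half_edges_def)
  moreover have "darts P \<subseteq> reachable (rot P) (opp P) (root_dart P)"
    using p(13) reachable_P'_P same by auto
  moreover have "half_edges P \<subseteq> orbit (contour P) (root_dart P)"
    using half_edges_P'(2) outer_half_edges[OF assms(1) outP'] assms(2)
    unfolding outer_orbit[OF outP] by auto
  moreover have "card (vertices P) + card (faces P) = card (edges P) + 2"
  proof -
    have "contour P permutes darts P"
      using permutes_compose[OF 1] p(2) same by (simp add: contour_def[abs_def] comp_def)
    from counts[OF this _ D 2] show ?thesis
      using p(1) assms(1) same by (simp add: planar_map_def)
  qed
  ultimately show ?thesis
    using p same by (simp add: planar_map_def)
qed

lemma leaves_buds:
  assumes "planar_map P"
  shows "leaves P' = insert l (leaves P)" "buds P' = insert b (buds P)" "l \<notin> leaves P" "b \<notin> buds P"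
    "half_edges P' = {b, l} \<union> half_edges P"
proof -
  have D: "b \<in> darts P" "l \<in> darts P"
    using planar_mapD(10)[OF assms, of b] planar_mapD(10)[OF assms, of l] oppP neq by auto
  show h: "half_edges P' = {b, l} \<union> half_edges P"
    by (rule half_edges_P'(1)[OF D])
  show "leaves P' = insert l (leaves P)" "buds P' = insert b (buds P)"
    using color same by (auto simp: leaves_def buds_def h)
  show "l \<notin> leaves P" "b \<notin> buds P"
    using oppP neq by (auto simp: leaves_def buds_def half_edges_def)
qed

end

text \<open>Asking for the black side on the outer face orients the cut: the new bud then precedes
  the new leaf on the outer walk, with the uncovered face between them, so that matching finds the
  pair again.\<close>

definition cuttable :: "rooted_map \<Rightarrow> nat \<Rightarrow> bool" where
  "cuttable P b \<longleftrightarrow> \<not> white P b \<and> b \<in> orbit (contour P) (root_dart P) \<and>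
     opp P b \<notin> orbit (contour P) (root_dart P)"

lemma surgery_detach:
  assumes "planar_map P" "white P (root_dart P)" "outer P ys" "cuttable P b"
  obtains A F C where "ys = A @ b # C" "surgery P (detach P b) A F C b (opp P b)"
proof -
  note p = planar_mapD[OF assms(1)]
  note o = outer_orbit[OF assms(3)]
  from assms(4) have b: "\<not> white P b" "b \<in> set ys" "opp P b \<notin> set ys"
    by (auto simp: cuttable_def o)
  then have ne: "opp P b \<noteq> b" by auto
  obtain A C where ys: "ys = A @ b # C"
    using split_list[OF b(2)] by blast
  have A: "A \<noteq> []"
    using assms(2,3) b(1) ys by (auto simp: outer_def)
  \<comment> \<open>Listed from the successor of \<open>opp P b\<close>, the face behind the edge
    ends with \<open>opp P b\<close>, as \<open>surgery\<close> requires.\<close>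
  obtain zs where zs: "cyc (contour P) zs" "hd zs = contour P (opp P b)"
    using cyc_exists[OF p(4,1)] by blast
  then have zs_ne: "zs \<noteq> []" by (auto simp: cyc_def)
  have "contour P (last zs) = contour P (opp P b)"
  proof -
    have "contour P (last zs) = last (map (contour P) zs)"
      using zs_ne by (simp add: last_map)
    also have "\<dots> = hd zs"
      using zs(1) zs_ne by (cases zs) (auto simp: cyc_def)
    finally show ?thesis using zs(2) by simp
  qed
  then have "last zs = opp P b"
    using permutes_inj[OF p(4)] by (simp add: inj_eq)
  then have F: "zs = butlast zs @ [opp P b]"
    using zs_ne append_butlast_last_id[of zs] by simp
  have disj: "set ys \<inter> set zs = {}"
  proof (rule ccontr)
    assume "set ys \<inter> set zs \<noteq> {}"
    then obtain x where x: "x \<in> set ys" "x \<in> set zs" by blast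
    then have "set ys = set zs"
      using cyc_orbit[OF zs(1)] cyc_orbit[of "contour P" ys] assms(3) by (auto simp: outer_def)
    moreover have "opp P b \<in> set zs" by (subst F) simp
    ultimately show False using b(3) by simp
  qed
  have "surgery P (detach P b) A (butlast zs) C b (opp P b)"
  proof
    show "white P (opp P b)"
      using p(9)[of b] p(10)[OF ne] b(1) ne by auto
  qed (use p ne b A F zs disj ys assms(3) in \<open>auto simp flip: F\<close>)
  then show ?thesis
    using that ys by blast
qed

lemma surgery_glue:
  assumes "planar_map P'" "outer P' (A @ b # F @ l # C)" "b \<in> buds P'" "l \<in> leaves P'" "A \<noteq> []"
  shows "surgery (glue P' b l) P' A F C b l"
proof
  have b: "opp P' b = b" "\<not> white P' b" and l: "opp P' l = l" "white P' l"
    using assms(3,4) by (auto simp: buds_def leaves_def half_edges_def)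
  have c: "cyc (contour P') (A @ b # F @ l # C)"
    using assms(2) by (simp add: outer_def)
  have contour: "contour (glue P' b l) b = contour P' l" "contour (glue P' b l) l = contour P' b"
     "\<And>x. x \<noteq> b \<Longrightarrow> x \<noteq> l \<Longrightarrow> contour (glue P' b l) x = contour P' x"
    using b l by (auto simp: contour_def)
  note s = cyc_split[OF c contour]
  show "outer (glue P' b l) (A @ b # C)"
    using s(1) assms(2,5) by (simp add: outer_def)
  show "cyc (contour (glue P' b l)) (F @ [l])"
    by (rule s(2))
  show "set (A @ b # C) \<inter> set (F @ [l]) = {}"
    using c by (auto simp: cyc_def)
qed (use assms in \<open>auto simp: buds_def leaves_def half_edges_def\<close>)

lemma glue_detach:
  assumes "opp P (opp P b) = b"
  shows "glue (detach P b) b (opp P b) = P"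
  using assms by (cases P) (auto simp: detach_def glue_def fun_eq_iff)

lemma detach_glue:
  assumes "opp P b = b" "opp P l = l"
  shows "detach (glue P b l) b = P"
  using assms by (cases P) (auto simp: detach_def glue_def fun_eq_iff)

section \<open>The closing relation: agreement with matching, and confluence\<close>

section \<open>Closing step by step\<close>

definition rooted_at_leaf :: "rooted_map \<Rightarrow> bool" where
  "rooted_at_leaf P \<longleftrightarrow> planar_map P \<and> white P (root_dart P)"

text \<open>The leaf stands behind the bud in a list headed by the root, so the root itself is never
  glued.\<close>

definition closes :: "rooted_map \<Rightarrow> rooted_map \<Rightarrow> bool" where
  "closes P' P \<longleftrightarrow> rooted_at_leaf P' \<and>
     (\<exists>A b F l C. outer P' (A @ b # F @ l # C) \<and> b \<in> buds P' \<and> l \<in> leaves P' \<and>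
        set F \<inter> half_edges P' = {} \<and> P = glue P' b l)"

lemma closesI:
  assumes "rooted_at_leaf P" "outer P (A @ b # F @ l # C)" "b \<in> buds P" "l \<in> leaves P"
    "set F \<inter> half_edges P = {}"
  shows "closes P (glue P b l)"
  using assms unfolding closes_def by blast

lemma closesE:
  assumes "closes P' P"
  obtains A b F l C where "surgery P P' A F C b l" "b \<in> buds P'" "l \<in> leaves P'"
    "set F \<inter> half_edges P' = {}" "P = glue P' b l" "rooted_at_leaf P'" "rooted_at_leaf P"
proof -
  from assms obtain A b F l C where *: "outer P' (A @ b # F @ l # C)" "b \<in> buds P'" "l \<in> leaves P'"
    "set F \<inter> half_edges P' = {}" "P = glue P' b l" and P': "rooted_at_leaf P'"
    by (auto simp: closes_def)
  have "A \<noteq> []"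
    using *(1,2) P' by (auto simp: outer_def rooted_at_leaf_def buds_def)
  then interpret surgery P P' A F C b l
    using * P' surgery_glue by (simp add: rooted_at_leaf_def)
  have "rooted_at_leaf P"
    using planar_P *(4) P' same by (simp add: rooted_at_leaf_def)
  then show ?thesis
    using that * P' surgery_axioms by blast
qed

text \<open>Read from the closed side, a step is fixed by one dart. Closings are convenient for
  comparing with the matching procedure, cuttable darts for choosing which edge to open.\<close>

lemma closes_iff_cuttable:
  "closes P' P \<longleftrightarrow> rooted_at_leaf P \<and> (\<exists>b. cuttable P b \<and> P' = detach P b)"
proof
  assume "closes P' P"
  then obtain A b F l C where s: "surgery P P' A F C b l" "b \<in> buds P'" "l \<in> leaves P'"
    "P = glue P' b l" "rooted_at_leaf P'" "rooted_at_leaf P"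
    by (rule closesE)
  interpret surgery P P' A F C b l by (rule s(1))
  have "cuttable P b"
    using color oppP disj by (auto simp: cuttable_def outer_orbit[OF outP])
  moreover have "P' = detach P b"
    using detach_glue[of P' b l] oppP' s(4) by simp
  ultimately show "rooted_at_leaf P \<and> (\<exists>b. cuttable P b \<and> P' = detach P b)"
    using s(6) by blast
next
  assume "rooted_at_leaf P \<and> (\<exists>b. cuttable P b \<and> P' = detach P b)"
  then obtain b where P: "planar_map P" "white P (root_dart P)" and b: "cuttable P b"
    and P': "P' = detach P b"
    by (auto simp: rooted_at_leaf_def)
  obtain ys where "outer P ys"
    using outer_exists[OF P(1)] .
  then obtain A F C where "surgery P P' A F C b (opp P b)"
    using surgery_detach[OF P] b P' by metis
  then interpret surgery P P' A F C b "opp P b" .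
  note h = leaves_buds[OF P(1)]
  \<comment> \<open>\<open>F\<close> belongs to an inner face of \<open>P\<close>, which carries no
    half-edge, and the two half-edges created by the cut lie outside \<open>F\<close>.\<close>
  have "set F \<inter> half_edges P' = {}"
    using h(5) outer_half_edges[OF P(1) outP] disj outer_distinct[OF outP'] by auto
  moreover have "b \<in> buds P'" "opp P b \<in> leaves P'"
    using h by auto
  moreover have "P = glue P' b (opp P b)"
    using glue_detach[OF planar_mapD(7)[OF P(1)]] P' by simp
  ultimately show "closes P' P"
    unfolding closes_def rooted_at_leaf_def using planar_P'[OF P(1)] P(2) same outP' by metis
qed

lemma filter_eq_append_ConsD:
  "filter Q ys = u @ b # v \<Longrightarrow> \<exists>ys1 ys2. ys = ys1 @ b # ys2 \<and> filter Q ys2 = v"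
proof (induction u arbitrary: ys)
  case Nil
  then show ?case by (auto dest!: filter_eq_ConsD)
next
  case (Cons a u)
  then obtain us vs where "ys = us @ a # vs" "filter Q vs = u @ b # v"
    by (auto dest!: filter_eq_ConsD)
  moreover from Cons.IH[OF this(2)] obtain ys1 ys2 where "vs = ys1 @ b # ys2" "filter Q ys2 = v"
    by blast
  ultimately have "ys = (us @ a # ys1) @ b # ys2 \<and> filter Q ys2 = v" by simp
  then show ?case by blast
qed

text \<open>Being neighbours among the elements satisfying \<open>Q\<close> depends only on the
  filtered list. This moves adjacency between the contour of the tree and that of a partly closed
  map.\<close>

lemma filter_consecutive:
  assumes "filter Q (A @ b # F @ l # C) = filter Q ys" "Q b" "Q l" "\<And>x. x \<in> set F \<Longrightarrow> \<not> Q x"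
  shows "\<exists>A' F' C'. ys = A' @ b # F' @ l # C' \<and> (\<forall>x\<in>set F'. \<not> Q x)"
proof -
  have "filter Q F = []"
    using assms(4) by (auto simp: filter_empty_conv)
  then have "filter Q ys = filter Q A @ b # l # filter Q C"
    using assms by simp
  then obtain u v where u: "ys = u @ b # v" "filter Q v = l # filter Q C"
    using filter_eq_append_ConsD by metis
  from filter_eq_ConsD[OF this(2)] obtain F' C' where "v = F' @ l # C'" "\<forall>x\<in>set F'. \<not> Q x"
    by blast
  then show ?thesis
    using u(1) by blast
qed

lemma closes_preserves:
  assumes "closes\<^sup>*\<^sup>* T P" "rooted_at_leaf T"
  shows "rooted_at_leaf P" "darts P = darts T" "rot P = rot T" "white P = white T"
    "root_dart P = root_dart T" "total_charge P = total_charge T" "vertices P = vertices T"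
proof -
  have "rooted_at_leaf P \<and> darts P = darts T \<and> rot P = rot T \<and> white P = white T \<and>
     root_dart P = root_dart T \<and> total_charge P = total_charge T"
    using assms(1)
  proof induction
    case base
    then show ?case using assms(2) by simp
  next
    case (step P' P)
    from step(2) obtain A b F l C where s: "surgery P P' A F C b l" "rooted_at_leaf P"
      by (rule closesE)
    interpret surgery P P' A F C b l by (rule s(1))
    have p: "planar_map P"
      using s(2) by (simp add: rooted_at_leaf_def)
    then have "finite (leaves P)" "finite (buds P)"
      using planar_mapD(1) by (auto simp: leaves_def buds_def half_edges_def)
    then have "total_charge P' = total_charge P"
      using leaves_buds[OF p] by (simp add: total_charge_def)
    then show ?case using step s(2) same by simp
  qed
  then show "rooted_at_leaf P" "darts P = darts T" "rot P = rot T" "white P = white T"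
    "root_dart P = root_dart T" "total_charge P = total_charge T" "vertices P = vertices T"
    by (simp_all add: vertices_def)
qed

text \<open>Matching always walks around the original tree, whereas closing walks around a shrinking
  outer face. Each step removes from the walk only \<open>F\<close>, which has no half-edges, and
  the matched leaf, so the remaining half-edges keep their order and both procedures see the same
  neighbours.\<close>

lemma closes_filter_unmatched:
  assumes "closes\<^sup>*\<^sup>* T P" "rooted_at_leaf T" "outer T xs" "outer P ys"
  shows "filter (\<lambda>x. x \<in> half_edges P) xs = filter (\<lambda>x. x \<in> half_edges P) ys"
    "unmatched T (half_edges P)"
proof -
  have "unmatched T (half_edges P) \<and> root_dart T \<in> half_edges P \<and>
      (\<forall>ys. outer P ys \<longrightarrow> filter (\<lambda>x. x \<in> half_edges P) xs = filter (\<lambda>x. x \<in> half_edges P) ys)"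
    using assms(1)
  proof induction
    case base
    then show ?case
      using unmatched.start assms(2,3) outer_unique
      by (auto simp: rooted_at_leaf_def planar_map_def)
  next
    case (step P' P)
    from step(2) obtain A b F l C where s: "surgery P P' A F C b l" "b \<in> buds P'" "l \<in> leaves P'"
      "set F \<inter> half_edges P' = {}" "rooted_at_leaf P"
      by (rule closesE)
    interpret surgery P P' A F C b l by (rule s(1))
    note pres = closes_preserves[OF step(1) assms(2)]
    have half: "half_edges P = half_edges P' - {b, l}"
      by (rule half_edges_P'(2))
    have bl: "b \<in> half_edges P'" "l \<in> half_edges P'"
      using s(2,3) by (auto simp: buds_def leaves_def)
    have IH: "filter (\<lambda>x. x \<in> half_edges P') (A @ b # F @ l # C) = filter (\<lambda>x. x \<in> half_edges P') xs"
      "root_dart T \<in> half_edges P'" "unmatched T (half_edges P')"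
      using step.IH outP' by auto
    obtain A' F' C' where xs: "xs = A' @ b # F' @ l # C'" "\<forall>x\<in>set F'. x \<notin> half_edges P'"
      using filter_consecutive[OF IH(1) bl] s(4) by blast
    have hd: "hd xs = root_dart T" "l \<noteq> root_dart T" "b \<noteq> root_dart T"
      using assms(3) neq same pres(5) by (auto simp: outer_def)
    have "next_in T (half_edges P') b l"
      unfolding next_in_def
      by (rule cyc_first_hit[THEN iffD2]) (use assms(3) hd IH(2) xs bl(2) in \<open>auto simp: outer_def\<close>)
    moreover have "b \<in> buds T" "l \<in> leaves T"
    proof -
      have "half_edges P' \<subseteq> half_edges T"
        using step(1)
      proof induction
        case (step Q Q')
        from step(2) obtain A b F l C where "surgery Q' Q A F C b l"
          by (rule closesE)
        then show ?case
          using surgery.half_edges_P'(2) step.IH by blast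
      qed simp
      then show "b \<in> buds T" "l \<in> leaves T"
        using s(2,3) pres(4) by (auto simp: buds_def leaves_def)
    qed
    ultimately have "matchable T (half_edges P') b l"
      using bl by (simp add: matchable_def)
    then have "unmatched T (half_edges P)"
      unfolding half by (rule unmatched.step[OF IH(3)])
    moreover have "filter (\<lambda>x. x \<in> half_edges P) xs = filter (\<lambda>x. x \<in> half_edges P) zs"
      if "outer P zs" for zs
    proof -
      have zs: "zs = A @ b # C"
        using outer_unique[OF that outP] .
      have "filter (\<lambda>x. x \<in> half_edges P) F = []"
        using s(4) half by (auto simp: filter_empty_conv)
      moreover have "filter (\<lambda>x. x \<in> half_edges P) ws =
          filter (\<lambda>x. x \<in> half_edges P) (filter (\<lambda>x. x \<in> half_edges P') ws)" for ws
        unfolding filter_filter by (rule filter_cong) (auto simp: half)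
      ultimately show ?thesis
        unfolding zs using half IH(1)
        by (metis (no_types, lifting) DiffD2 append_Nil filter.simps(2) filter_append insertCI)
    qed
    moreover have "root_dart T \<in> half_edges P"
      using IH(2) hd by (simp add: half)
    ultimately show ?case by blast
  qed
  then show "filter (\<lambda>x. x \<in> half_edges P) xs = filter (\<lambda>x. x \<in> half_edges P) ys"
    "unmatched T (half_edges P)"
    using assms(4) by auto
qed

text \<open>While the root is among the unmatched half-edges, no matched pair can reach across it,
  so every matching step is visible in the list headed by the root and can be imitated by
  glueing.\<close>

lemma unmatched_closes:
  assumes "unmatched T R" "root_dart T \<in> R" "rooted_at_leaf T"
  shows "\<exists>P. closes\<^sup>*\<^sup>* T P \<and> half_edges P = R"
  using assms(1,2)
proof induction
  case start
  then show ?case by blast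
next
  case (step R b l)
  then obtain P' where P': "closes\<^sup>*\<^sup>* T P'" "half_edges P' = R" by auto
  note pres = closes_preserves[OF P'(1) assms(3)]
  obtain xs where xs: "outer T xs"
    using outer_exists assms(3) by (auto simp: rooted_at_leaf_def)
  obtain ys where ys: "outer P' ys"
    using outer_exists pres(1) by (auto simp: rooted_at_leaf_def)
  from step(2) have m: "b \<in> R" "b \<in> buds T" "l \<in> R" "l \<in> leaves T" "next_in T R b l"
    by (auto simp: matchable_def)
  have ne: "l \<noteq> root_dart T" "b \<noteq> root_dart T"
    using step.prems by auto
  have "set xs \<supseteq> half_edges T"
    using outer_half_edges xs assms(3) by (simp add: rooted_at_leaf_def)
  then have "b \<in> set xs"
    using m(2) by (auto simp: buds_def)
  then obtain A F C where "xs = A @ b # F @ l # C" "set F \<inter> R = {}"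
    using cyc_first_hit[of "contour T" xs R b l] m(5) xs step.prems ne
    by (auto simp: next_in_def outer_def)
  moreover have "filter (\<lambda>x. x \<in> R) xs = filter (\<lambda>x. x \<in> R) ys"
    using closes_filter_unmatched(1)[OF P'(1) assms(3) xs ys] P'(2) by simp
  ultimately obtain A' F' C' where "ys = A' @ b # F' @ l # C'" "\<forall>x\<in>set F'. x \<notin> R"
    using filter_consecutive[of "\<lambda>x. x \<in> R" A b F l C ys] m(1,3) by blast
  moreover have "b \<in> buds P'" "l \<in> leaves P'"
    using m P'(2) pres(4) by (auto simp: buds_def leaves_def)
  ultimately have c: "closes P' (glue P' b l)"
    unfolding closes_def using ys pres(1) P'(2) by blast
  then have "closes\<^sup>*\<^sup>* T (glue P' b l)"
    using P'(1) by simp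
  moreover have "half_edges (glue P' b l) = R - {b, l}"
    using \<open>b \<in> buds P'\<close> \<open>l \<in> leaves P'\<close> P'(2)
    by (auto simp: half_edges_def buds_def leaves_def split: if_splits)
  ultimately show ?case by blast
qed

text \<open>The two pairs occupy disjoint intervals of the outer list. Glueing one of them deletes
  its interval behind the bud and leaves the other interval contiguous.\<close>

lemma closes_commute:
  assumes "rooted_at_leaf P" "outer P (A @ b # F @ l # D @ b' # F' @ l' # C)"
    "b \<in> buds P" "l \<in> leaves P" "set F \<inter> half_edges P = {}"
    "b' \<in> buds P" "l' \<in> leaves P" "set F' \<inter> half_edges P = {}"
  shows "\<exists>Q. closes (glue P b l) Q \<and> closes (glue P b' l') Q"
proof -
  have 1: "closes P (glue P b l)"
    by (rule closesI[OF assms(1-5)])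
  have o: "outer P ((A @ b # F @ l # D) @ b' # F' @ l' # C)"
    using assms(2) by simp
  have 2: "closes P (glue P b' l')"
    by (rule closesI[OF assms(1) o assms(6-8)])
  have d: "distinct (A @ b # F @ l # D @ b' # F' @ l' # C)"
    by (rule outer_distinct[OF assms(2)])
  have A: "A \<noteq> []"
    using assms(1-3) by (auto simp: outer_def rooted_at_leaf_def buds_def)
  have P: "planar_map P"
    using assms(1) by (simp add: rooted_at_leaf_def)
  interpret s1: surgery "glue P b l" P A F "D @ b' # F' @ l' # C" b l
    by (rule surgery_glue[OF P assms(2,3,4) A])
  interpret s2: surgery "glue P b' l'" P "A @ b # F @ l # D" F' C b' l'
    by (rule surgery_glue[OF P o assms(6,7)]) simp
  have h1: "half_edges (glue P b l) = half_edges P - {b, l}"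
    by (rule s1.half_edges_P'(2))
  have h2: "half_edges (glue P b' l') = half_edges P - {b', l'}"
    by (rule s2.half_edges_P'(2))
  have o1: "outer (glue P b l) ((A @ b # D) @ b' # F' @ l' # C)"
    using s1.outP by simp
  have o2: "outer (glue P b' l') (A @ b # F @ l # (D @ b' # C))"
    using s2.outP by simp
  have r: "rooted_at_leaf (glue P b l)" "rooted_at_leaf (glue P b' l')"
    using closes_preserves(1)[OF _ assms(1)] 1 2 by blast+
  have "closes (glue P b l) (glue (glue P b l) b' l')"
    by (rule closesI[OF r(1) o1]) (use assms(6-8) d in \<open>auto simp: buds_def leaves_def h1\<close>)
  moreover have "closes (glue P b' l') (glue (glue P b' l') b l)"
    by (rule closesI[OF r(2) o2]) (use assms(3-5) d in \<open>auto simp: buds_def leaves_def h2\<close>)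
  moreover have "b \<noteq> b'" "b \<noteq> l'" "l \<noteq> b'" "l \<noteq> l'"
    using d by auto
  then have "glue (glue P b l) b' l' = glue (glue P b' l') b l"
    by (simp add: glue_def fun_upd_twist)
  ultimately show ?thesis by auto
qed

text \<open>The half-edge following a bud on the outer list is unique. Hence two admissible pairs
  are equal or occupy disjoint intervals, and in the second case they commute after one more step on
  each side.\<close>

lemma confluent_closes: "confluentp closes"
proof (rule strong_confluentp_imp_confluentp, rule strong_confluentpI)
  fix P Q Q' assume "closes P Q" "closes P Q'"
  then obtain A b F l C A' b' F' l' C' where P: "rooted_at_leaf P" and
    1: "outer P (A @ b # F @ l # C)" "b \<in> buds P" "l \<in> leaves P"
      "set F \<inter> half_edges P = {}" "Q = glue P b l" and
    2: "outer P (A' @ b' # F' @ l' # C')" "b' \<in> buds P" "l' \<in> leaves P"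
      "set F' \<inter> half_edges P = {}" "Q' = glue P b' l'"
    unfolding closes_def by blast
  have eq: "A @ b # F @ l # C = A' @ b' # F' @ l' # C'"
    by (rule outer_unique[OF 1(1) 2(1)])
  have d: "distinct (A @ b # F @ l # C)"
    by (rule outer_distinct[OF 1(1)])
  have half: "b \<in> half_edges P" "l \<in> half_edges P" "b' \<in> half_edges P" "l' \<in> half_edges P"
      "b' \<noteq> l" "b \<noteq> l'"
    using 1 2 by (auto simp: buds_def leaves_def)
  \<comment> \<open>Both leaves are the first half-edge behind the same bud, so \<open>F\<close> and
    \<open>F'\<close> are the same maximal prefix without half-edges.\<close>
  have first: "l = l' \<and> C = C'" if "F @ l # C = F' @ l' # C'"
  proof -
    have "F = takeWhile (\<lambda>x. x \<notin> half_edges P) (F @ l # C)"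
        "F' = takeWhile (\<lambda>x. x \<notin> half_edges P) (F' @ l' # C')"
      using 1(4) 2(4) half by (subst takeWhile_append2; auto)+
    then show ?thesis using that by (metis append_same_eq same_append_eq list.inject)
  qed
  have "b = b' \<and> l = l' \<or> (\<exists>D. C = D @ b' # F' @ l' # C') \<or> (\<exists>D. C' = D @ b # F @ l # C)"
  proof -
    have "b' \<in> set (A @ b # F @ l # C)" unfolding eq by simp
    moreover have "b' \<notin> set F" using half(3) 1(4) by blast
    ultimately consider "b' = b" | "b' \<in> set C" | "b' \<in> set A" using half(5) by auto
    then show ?thesis
    proof cases
      case 1
      moreover have "b \<notin> set A" "b \<notin> set (F @ l # C)"
        using d by auto
      ultimately have "F @ l # C = F' @ l' # C'"
        using eq append_Cons_eq_iff[of b A "F @ l # C" A' "F' @ l' # C'"] by metis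
      then show ?thesis using first 1 by blast
    next
      case 2
      then obtain D E where C: "C = D @ b' # E" by (meson split_list)
      then have "(A @ b # F @ l # D) @ b' # E = A' @ b' # F' @ l' # C'"
        using eq by simp
      moreover have "b' \<notin> set (A @ b # F @ l # D)" "b' \<notin> set E"
        using d C by auto
      ultimately have "E = F' @ l' # C'"
        using append_Cons_eq_iff[of b' "A @ b # F @ l # D" E] by blast
      then show ?thesis using C by blast
    next
      case 3
      then obtain D E where A: "A = D @ b' # E" by (meson split_list)
      then have "D @ b' # (E @ b # F @ l # C) = A' @ b' # F' @ l' # C'"
        using eq by simp
      moreover have "b' \<notin> set D" "b' \<notin> set (E @ b # F @ l # C)"
        using d A by auto
      ultimately have *: "E @ b # F @ l # C = F' @ l' # C'"
        using append_Cons_eq_iff[of b' D "E @ b # F @ l # C"] by blast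
      then have "b \<in> set (F' @ l' # C')" by (metis in_set_conv_decomp)
      moreover have "b \<notin> set F'" using half(1) 2(4) by blast
      ultimately have "b \<in> set C'" using half(6) by auto
      then obtain D' E' where C': "C' = D' @ b # E'" by (meson split_list)
      have "(F' @ l' # D') @ b # E' = E @ b # F @ l # C"
        using * C' by simp
      moreover have "b \<notin> set E" "b \<notin> set (F @ l # C)"
        using d A by auto
      ultimately have "E' = F @ l # C"
        using append_Cons_eq_iff[of b E "F @ l # C" "F' @ l' # D'" E'] by metis
      then show ?thesis using C' by blast
    qed
  qed
  then consider "b = b'" "l = l'" | D where "C = D @ b' # F' @ l' # C'"
    | D where "C' = D @ b # F @ l # C" by blast
  then show "\<exists>u. closes\<^sup>*\<^sup>* Q u \<and> closes\<^sup>=\<^sup>= Q' u"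
  proof cases
    case 1
    then show ?thesis using \<open>Q = _\<close> \<open>Q' = _\<close> by auto
  next
    case 2
    then show ?thesis
      using closes_commute[OF P, of A b F l D b' F' l' C'] 1 2(1) \<open>b' \<in> buds P\<close> \<open>l' \<in> leaves P\<close>
        \<open>set F' \<inter> _ = {}\<close> \<open>Q' = _\<close> by auto
  next
    case 3
    then show ?thesis
      using closes_commute[OF P, of A' b' F' l' D b F l C] 1 2
        \<open>outer P (A' @ b' # F' @ l' # C')\<close> \<open>b' \<in> buds P\<close> \<open>l' \<in> leaves P\<close>
        \<open>set F' \<inter> _ = {}\<close> \<open>Q' = _\<close> by auto
  qed
qed

text \<open>Every step consumes a bud, so a map without buds is a normal form of a confluent
  relation.\<close>

lemma closure_unique:
  assumes "closes\<^sup>*\<^sup>* T M" "closes\<^sup>*\<^sup>* T M'" "buds M = {}" "buds M' = {}"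
  shows "M = M'"
proof -
  obtain u where u: "closes\<^sup>*\<^sup>* M u" "closes\<^sup>*\<^sup>* M' u"
    using confluentpD[OF confluent_closes assms(1,2)] by blast
  have "\<not> closes Q v" if "buds Q = {}" for Q v
    using that by (auto simp: closes_def)
  then have "M = u" "M' = u"
    using u assms(3,4) by (metis converse_rtranclpE)+
  then show ?thesis by simp
qed

section \<open>Lower subtrees as intervals of the contour, charges as height differences\<close>

section \<open>Charges of subtrees\<close>

lemma orbit_permutes_eq:
  assumes "s permutes D" "finite D" "y \<in> orbit s x"
  shows "orbit s y = orbit s x"
proof -
  obtain ys where ys: "cyc s ys" "hd ys = x"
    using cyc_exists[OF assms(1,2)] .
  then have "x \<in> set ys" by (auto simp: cyc_def)
  then show ?thesis
    using cyc_orbit[OF ys(1)] assms(3) by simp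
qed

text \<open>Grow a connected set of darts, each step adding one vertex and at least one edge.\<close>

lemma card_vertices_le_edges:
  assumes "finite D" "s permutes D" "\<And>d. d \<in> D \<Longrightarrow> a d \<in> D" "r \<in> D" "D \<subseteq> reachable s a r"
  shows "card (orbit s ` D) \<le> card {{d, a d} | d. d \<in> D \<and> a d \<noteq> d} + 1"
proof -
  define E where "E S = {{d, a d} | d. d \<in> S \<and> a d \<in> S \<and> a d \<noteq> d}" for S
  define good where "good S \<longleftrightarrow> S \<subseteq> D \<and> r \<in> S \<and> s ` S \<subseteq> S \<and> card (orbit s ` S) \<le> card (E S) + 1" for S
  have perm: "permutation s"
    using assms(1,2) permutation_permutes by blast
  have orb: "orbit s x \<subseteq> D" "s ` orbit s x \<subseteq> orbit s x" "x \<in> orbit s x"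
    "orbit s ` orbit s x = {orbit s x}" if "x \<in> D" for x
  proof -
    show "orbit s x \<subseteq> D" by (rule permutes_orbit_subset[OF assms(2) that])
    show "s ` orbit s x \<subseteq> orbit s x" by (auto intro: orbit.step)
    show x: "x \<in> orbit s x" by (rule permutation_self_in_orbit[OF perm])
    show "orbit s ` orbit s x = {orbit s x}"
      using x by (intro image_eq_singleton orbit_permutes_eq[OF assms(2,1)]) auto
  qed
  have fE: "finite (E S)" if "S \<subseteq> D" for S
  proof -
    have "E S \<subseteq> (\<lambda>d. {d, a d}) ` D" using that by (auto simp: E_def)
    then show ?thesis using assms(1) finite_surj by blast
  qed
  have "card (orbit s ` orbit s r) \<le> 1"
    unfolding orb(4)[OF assms(4)] by simp
  then have g: "good (orbit s r)"
    unfolding good_def using orb(1-3)[OF assms(4)] by (intro conjI) linarith+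
  have bound: "card S \<le> card D" if "good S" for S
    using that card_mono[OF assms(1)] unfolding good_def by blast
  have "\<exists>S. good S \<and> (\<forall>S'. good S' \<longrightarrow> card S' \<le> card S)"
    by (rule ex_has_greatest_nat[of good, OF g, of _ "Suc (card D)"]) (use bound in \<open>simp add: less_Suc_eq_le\<close>)
  then obtain S where S: "good S" and max: "\<And>S'. good S' \<Longrightarrow> card S' \<le> card S"
    by blast
  have "a d \<in> S" if "d \<in> S" for d
  proof (rule ccontr)
    assume n: "a d \<notin> S"
    let ?O = "orbit s (a d)"
    have D: "d \<in> D" "a d \<in> D" using that S assms(3) by (auto simp: good_def)
    note o = orb[OF D(2)]
    have "insert {d, a d} (E S) \<subseteq> E (S \<union> ?O)"
      using that n o(3) by (auto simp: E_def)
    then have "card (insert {d, a d} (E S)) \<le> card (E (S \<union> ?O))"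
      using fE[of "S \<union> ?O"] S o(1) by (intro card_mono) (auto simp: good_def)
    moreover have "{d, a d} \<notin> E S"
      using n by (auto simp: E_def doubleton_eq_iff)
    ultimately have "card (E S) + 1 \<le> card (E (S \<union> ?O))"
      using fE S by (simp add: good_def)
    moreover have "card (orbit s ` (S \<union> ?O)) \<le> card (orbit s ` S) + 1"
      unfolding image_Un o(4) using card_Un_le[of "orbit s ` S" "{?O}"] by simp
    moreover have "card (orbit s ` S) \<le> card (E S) + 1" "S \<subseteq> D" "r \<in> S" "s ` S \<subseteq> S"
      using S by (simp_all add: good_def)
    ultimately have "good (S \<union> ?O)"
      unfolding good_def image_Un[of s] using o(1,2) by (intro conjI) (linarith | blast)+
    moreover have "card S < card (S \<union> ?O)"
      using n o(1,3) S assms(1) finite_subset[of "S \<union> ?O" D]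
      by (intro psubset_card_mono) (auto simp: good_def)
    ultimately show False using max by fastforce
  qed
  moreover have "s d \<in> S" if "d \<in> S" for d
    using S that by (auto simp: good_def)
  moreover have "e \<in> S" if "(\<lambda>x y. y = s x \<or> y = a x)\<^sup>*\<^sup>* r e" for e
    using that
  proof induction
    case base
    then show ?case using S by (simp add: good_def)
  next
    case (step y z)
    then show ?case using calculation by auto
  qed
  ultimately have "S = D"
    using assms(5) S by (auto simp: reachable_def good_def)
  moreover have "E D = {{d, a d} | d. d \<in> D \<and> a d \<noteq> d}"
    using assms(3) unfolding E_def by blast
  ultimately show ?thesis using S by (simp add: good_def)
qed

lemma tree_outer_darts:
  assumes "tree T" "outer T ys" shows "set ys = darts T"
proof -
  have T: "planar_map T" "card (faces T) = 1"
    using assms by (auto simp: tree_def)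
  note p = planar_mapD[OF T(1)]
  have "permutation (contour T)"
    using p(1,4) permutation_permutes by blast
  then have self: "d \<in> orbit (contour T) d" for d
    by (rule permutation_self_in_orbit)
  obtain X where X: "faces T = {X}"
    using T(2) card_1_singletonE by blast
  have "orbit (contour T) d = X" if "d \<in> darts T" for d
    using that X unfolding faces_def by blast
  then have "d \<in> orbit (contour T) (root_dart T)" if "d \<in> darts T" for d
    using self[of d] that p(5) by metis
  then show ?thesis
    using outer_darts[OF T(1) assms(2)] outer_orbit[OF assms(2)] by auto
qed

lemma outer_darts_tree:
  assumes "planar_map P" "outer P ys" "set ys = darts P" shows "tree P"
proof -
  have "faces P = {set ys}"
    unfolding faces_def assms(3)[symmetric]
    by (rule image_eq_singleton, use outer_root[OF assms(2)] in simp)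
      (rule outer_orbit_mem[OF assms(2)])
  then show ?thesis
    using assms(1) by (simp add: tree_def)
qed

text \<open>Cutting an edge of a tree splits its only face into the cycles through
  \<open>A @ x # C\<close> and \<open>B @ [y]\<close>, and each of them lies in one component. A
  common component would leave all darts connected with one edge fewer, so there would be at most as
  many vertices as the tree has edges; Euler's formula gives one vertex more.\<close>

lemma cut_darts:
  assumes "tree T" "outer T (A @ x # B @ y # C)" "opp T x = y"
  shows "darts (cut T y) = set (B @ [y])" "set (A @ x # C) \<subseteq> darts (cut T x)"
proof -
  have T: "planar_map T" "card (faces T) = 1"
    using assms by (auto simp: tree_def)
  note p = planar_mapD[OF T(1)]
  have opp: "opp T y = x"
    using p(7) assms(3) by metis
  have d: "distinct (A @ x # B @ y # C)"
    by (rule outer_distinct[OF assms(2)])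
  define a where "a = (opp T)(x := x, y := y)"
  define c where "c d = rot T (a d)" for d
  have c: "c x = contour T y" "c y = contour T x" "\<And>z. z \<noteq> x \<Longrightarrow> z \<noteq> y \<Longrightarrow> c z = contour T z"
    using assms(3) opp d by (auto simp: c_def a_def contour_def)
  have cyc: "cyc c (A @ x # C)" "cyc c (B @ [y])"
    using cyc_split[of "contour T" A x B y C c] assms(2) c by (auto simp: outer_def)
  have darts: "darts (cut T x) = reachable (rot T) a x" "darts (cut T y) = reachable (rot T) a y"
    using d by (auto simp: cut_def Let_def a_def assms(3) opp fun_upd_twist)
  have orb: "z \<in> reachable (rot T) a u" if "z \<in> orbit c u" for z u
    using orbit_reachable[of z "rot T" a u] that by (simp add: c_def[abs_def])
  have *: "set (A @ x # C) \<subseteq> reachable (rot T) a u" if "u \<in> set (A @ x # C)" for u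
    using cyc_orbit[OF cyc(1) that] orb by blast
  then show "set (A @ x # C) \<subseteq> darts (cut T x)"
    unfolding darts by simp
  have 1: "set (B @ [y]) \<subseteq> reachable (rot T) a y"
    using cyc_orbit[OF cyc(2), of y] orb by auto
  have D: "darts T = set (A @ x # B @ y # C)"
    using tree_outer_darts[OF assms(1,2)] by simp
  have aD: "a d \<in> darts T" if "d \<in> darts T" for d
    using that p(12) by (auto simp: a_def)
  have "e \<in> darts T" if "(\<lambda>u v. v = rot T u \<or> v = a u)\<^sup>*\<^sup>* y e" for e
    using that
  proof induction
    case base
    then show ?case using D by simp
  next
    case (step u v)
    then show ?case using aD[of u] p(11)[of u] by metis
  qed
  then have 2: "reachable (rot T) a y \<subseteq> darts T"
    unfolding reachable_def by blast
  have 3: "u \<notin> set (A @ x # C)" if u: "u \<in> reachable (rot T) a y" for u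
  proof
    assume "u \<in> set (A @ x # C)"
    moreover have "reachable (rot T) a u \<subseteq> reachable (rot T) a y"
      using u rtranclp_trans unfolding reachable_def by fast
    ultimately have "set (A @ x # C) \<subseteq> reachable (rot T) a y"
      using *[of u] by (meson subset_trans)
    then have R: "darts T \<subseteq> reachable (rot T) a y"
      unfolding D using 1 by auto
    have "y \<in> darts T"
      by (simp add: D)
    then have "card (vertices T) \<le> card {{d, a d} | d. d \<in> darts T \<and> a d \<noteq> d} + 1"
      unfolding vertices_def using card_vertices_le_edges[OF p(1,2) _ _ R] aD by blast
    moreover have "card (edges T) = card {{d, a d} | d. d \<in> darts T \<and> a d \<noteq> d} + 1"
      unfolding edges_def
      by (rule card_edges_cut[OF p(1), of x y]) (use D d assms(3) opp in \<open>auto simp: a_def\<close>)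
    ultimately show False
      using T by (simp add: planar_map_def)
  qed
  show "darts (cut T y) = set (B @ [y])"
  proof (intro equalityI subsetI)
    fix u assume u: "u \<in> darts (cut T y)"
    then have "u \<in> darts T" "u \<notin> set (A @ x # C)"
      using 2 3[of u] unfolding darts by blast+
    then show "u \<in> set (B @ [y])" by (auto simp: D)
  qed (use 1 darts in blast)
qed

definition weight :: "rooted_map \<Rightarrow> nat \<Rightarrow> int" where
  "weight P x = (if x \<in> buds P then 1 else if x \<in> leaves P - {root_dart P} then -1 else 0)"

definition height :: "(nat \<Rightarrow> int) \<Rightarrow> nat list \<Rightarrow> nat \<Rightarrow> int" where
  "height w ys x = sum_list (map w (takeWhile (\<lambda>z. z \<noteq> x) ys))"

definition position :: "nat list \<Rightarrow> nat \<Rightarrow> nat" where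
  "position ys x = length (takeWhile (\<lambda>z. z \<noteq> x) ys)"

text \<open>On a tree this constrains every edge. On a partly opened map it is silent about edges
  with a side on an inner face, so it can serve as an invariant of the opening.\<close>

definition well_charged :: "rooted_map \<Rightarrow> nat list \<Rightarrow> bool" where
  "well_charged P ys \<longleftrightarrow> (\<forall>b\<in>set ys. \<not> white P b \<and> opp P b \<noteq> b \<and> opp P b \<in> set ys \<longrightarrow>
     height (weight P) ys (opp P b) \<le> height (weight P) ys b + 1 \<and>
     (position ys b < position ys (opp P b) \<longrightarrow>
        height (weight P) ys (opp P b) \<le> height (weight P) ys b))"

lemma takeWhile_split: "x \<notin> set A \<Longrightarrow> takeWhile (\<lambda>z. z \<noteq> x) (A @ x # C) = A"
  by (subst takeWhile_append2) auto

lemma height_position_split: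
  assumes "distinct (A @ x # C)"
  shows "height w (A @ x # C) x = sum_list (map w A)" "position (A @ x # C) x = length A"
  using assms by (simp_all add: height_def position_def takeWhile_split)

lemma split_list_position:
  assumes "x \<in> set ys" "y \<in> set ys" "position ys x < position ys y" "distinct ys"
  obtains A B C where "ys = A @ x # B @ y # C"
proof -
  obtain A D where ys: "ys = A @ x # D"
    using split_list[OF assms(1)] by blast
  have "y \<notin> set A"
  proof
    assume "y \<in> set A"
    then obtain A1 A2 where "A = A1 @ y # A2" by (meson split_list)
    then show False
      using assms(3,4) ys height_position_split(2)[of A x D] height_position_split(2)[of A1 y "A2 @ x # D"]
      by simp
  qed
  moreover have "y \<noteq> x" using assms(3) by blast
  ultimately have "y \<in> set D" using assms(2) ys by simp
  then obtain B C where "D = B @ y # C" by (meson split_list)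
  then show ?thesis using that ys by blast
qed

lemma position_inj:
  assumes "x \<in> set ys" "y \<in> set ys" "position ys x = position ys y"
  shows "x = y"
proof -
  have "takeWhile (\<lambda>z. z \<noteq> u) ys @ u # tl (dropWhile (\<lambda>z. z \<noteq> u) ys) = ys" if "u \<in> set ys" for u
  proof -
    have "dropWhile (\<lambda>z. z \<noteq> u) ys \<noteq> []" using that by (simp add: dropWhile_eq_Nil_conv)
    then have "dropWhile (\<lambda>z. z \<noteq> u) ys = u # tl (dropWhile (\<lambda>z. z \<noteq> u) ys)"
      using hd_dropWhile by (metis (mono_tags, lifting) list.collapse)
    then show ?thesis by (metis takeWhile_dropWhile_id)
  qed
  from this[OF assms(1)] this[OF assms(2)] show ?thesis
    using assms(3) unfolding position_def by (metis nth_append_length)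
qed

text \<open>Between the two sides the walk visits precisely \<open>B\<close>, and \<open>x\<close>
  weighs nothing as a side of an edge. Weights count buds minus leaves and charges leaves minus
  buds, hence the height of the earlier side comes first in the difference.\<close>

lemma charge_cut:
  assumes "tree T" "outer T (A @ x # B @ y # C)" "opp T x = y" "A \<noteq> []"
  shows "charge (cut T y) =
      height (weight T) (A @ x # B @ y # C) x - height (weight T) (A @ x # B @ y # C) y"
proof -
  have T: "planar_map T"
    using assms(1) by (simp add: tree_def)
  note p = planar_mapD[OF T]
  have d: "distinct (A @ x # B @ y # C)"
    by (rule outer_distinct[OF assms(2)])
  have opp: "opp T y = x"
    using p(7) assms(3) by metis
  have ne: "x \<noteq> y" using d by auto
  have root: "root_dart T \<notin> set B"
    using assms(2,4) d by (cases A) (auto simp: outer_def)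
  have Z: "darts (cut T y) = set (B @ [y])"
    by (rule cut_darts(1)[OF assms(1-3)])
  have half: "half_edges (cut T y) = insert y (half_edges T \<inter> set B)"
  proof -
    have "opp (cut T y) = perm_restrict ((opp T)(y := y, x := x)) (darts (cut T y))"
      by (simp add: cut_def Let_def opp)
    then have opp_cut: "opp (cut T y) z = ((opp T)(y := y, x := x)) z" if "z \<in> set (B @ [y])" for z
      using that Z by (simp add: perm_restrict_def)
    have "x \<notin> set B" "y \<notin> set B" using d by auto
    then have "opp (cut T y) z = opp T z" if "z \<in> set B" for z
      using opp_cut[of z] that by (auto simp: fun_upd_def)
    moreover have "opp (cut T y) y = y"
      using opp_cut[of y] ne by simp
    moreover have "set B \<subseteq> darts T"
      using outer_darts[OF T assms(2)] by auto
    ultimately show ?thesis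
      unfolding half_edges_def Z by auto
  qed
  have y: "y \<notin> set B" using d by auto
  have root_cut: "root_dart (cut T y) = y" "white (cut T y) = white T"
    by (simp_all add: cut_def Let_def)
  have lb: "leaves (cut T y) - {y} = leaves T \<inter> set B" "buds (cut T y) - {y} = buds T \<inter> set B"
    unfolding leaves_def buds_def half root_cut using y by auto
  \<comment> \<open>The weights ignore the root, so charge and weight sum can be compared only on
    lists that avoid it.\<close>
  have "int (card (leaves T \<inter> set X)) - int (card (buds T \<inter> set X)) = - sum_list (map (weight T) X)"
    if "distinct X" "root_dart T \<notin> set X" for X
    using that
  proof (induction X)
    case (Cons z X)
    have "leaves T \<inter> buds T = {}"
      by (auto simp: leaves_def buds_def)
    then consider "z \<in> leaves T" "z \<notin> buds T" | "z \<notin> leaves T" "z \<in> buds T"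
      | "z \<notin> leaves T" "z \<notin> buds T" by blast
    then show ?case
      using Cons by cases (auto simp: weight_def)
  qed simp
  then have "charge (cut T y) = - sum_list (map (weight T) B)"
    unfolding charge_def root_cut lb using d root by simp
  moreover have "weight T x = 0"
    using assms(3) ne by (auto simp: weight_def buds_def leaves_def half_edges_def)
  moreover have "distinct ((A @ x # B) @ y # C)" using d by simp
  then have "height (weight T) ((A @ x # B) @ y # C) y = sum_list (map (weight T) (A @ x # B))"
    by (rule height_position_split(1))
  ultimately show ?thesis
    using height_position_split(1)[OF d] by simp
qed

text \<open>The lower subtree hangs at the side met later. If that side is white, charge at least 0
  means that it is not higher than the black side; if it is black, charge at most 1 means that the
  white side is at most one level higher. The first clause of \<open>well_charged\<close> also
  covers the former case, where it is weaker than the second.\<close>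

lemma blossom_tree_iff:
  assumes "tree T" "white T (root_dart T)" "outer T ys"
  shows "blossom_tree T \<longleftrightarrow> well_charged T ys"
proof -
  let ?h = "height (weight T) ys"
  have T: "planar_map T"
    using assms(1) by (simp add: tree_def)
  note p = planar_mapD[OF T]
  have d: "distinct ys"
    by (rule outer_distinct[OF assms(3)])
  have D: "darts T = set ys"
    using tree_outer_darts[OF assms(1,3)] by simp
  have root_pos: "A \<noteq> []" if "ys = A @ x # C" "opp T x \<noteq> x" for A x C
    using that assms(3) p(6) by (auto simp: outer_def)
  have lower: "charge (cut T y) = ?h (opp T y) - ?h y \<and> root_dart T \<notin> darts (cut T y)"
    if "y \<in> set ys" "opp T y \<noteq> y" "position ys (opp T y) < position ys y" for y
  proof -
    have "opp T y \<in> set ys" using that(1) p(12) D by simp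
    from split_list_position[OF this that(1,3) d]
    obtain A B C where ys: "ys = A @ opp T y # B @ y # C" .
    have A: "A \<noteq> []" using root_pos[OF ys] that(2) p(7) by simp
    have "root_dart T \<notin> set (B @ [y])"
      using A assms(3) d ys by (cases A) (auto simp: outer_def)
    then show ?thesis
      using charge_cut[of T A "opp T y" B y C] cut_darts(1)[of T A "opp T y" B y C]
        assms(1,3) A ys p(7) by simp
  qed
  have upper: "root_dart T \<in> darts (cut T x)"
    if "x \<in> set ys" "opp T x \<noteq> x" "position ys x < position ys (opp T x)" for x
  proof -
    have "opp T x \<in> set ys" using that(1) p(12) D by simp
    from split_list_position[OF that(1) this that(3) d]
    obtain A B C where ys: "ys = A @ x # B @ opp T x # C" .
    have "A \<noteq> []" using root_pos[OF ys] that(2) by simp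
    then have "root_dart T \<in> set (A @ x # C)"
      using assms(3) ys by (cases A) (auto simp: outer_def)
    then show ?thesis
      using cut_darts(2)[of T A x B "opp T x" C] assms(1,3) ys by blast
  qed
  have neq: "position ys x < position ys (opp T x) \<or> position ys (opp T x) < position ys x"
    if "x \<in> set ys" "opp T x \<noteq> x" for x
    using that position_inj[of x ys "opp T x"] p(12) D by (metis linorder_neqE_nat)
  have white: "white T (opp T x) \<longleftrightarrow> \<not> white T x" if "x \<in> set ys" "opp T x \<noteq> x" for x
    using that p(9) D by auto
  \<comment> \<open>By \<open>lower\<close> and \<open>upper\<close>, the part cut off at
    \<open>y\<close> avoids the root exactly when \<open>y\<close> is the later side of its
    edge.\<close>
  have "blossom_tree T \<longleftrightarrow> (\<forall>y\<in>set ys. opp T y \<noteq> y \<and> position ys (opp T y) < position ys y \<longrightarrow>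
      (if white T y then 0 \<le> ?h (opp T y) - ?h y else ?h (opp T y) - ?h y \<le> 1))"
    unfolding blossom_tree_def D using assms(1) lower upper neq by (metis (no_types, lifting))
  also have "\<dots> \<longleftrightarrow> well_charged T ys"
  proof
    assume L: "\<forall>y\<in>set ys. opp T y \<noteq> y \<and> position ys (opp T y) < position ys y \<longrightarrow>
      (if white T y then 0 \<le> ?h (opp T y) - ?h y else ?h (opp T y) - ?h y \<le> 1)"
    show "well_charged T ys"
      unfolding well_charged_def
    proof (intro ballI impI)
      fix b assume b: "b \<in> set ys" "\<not> white T b \<and> opp T b \<noteq> b \<and> opp T b \<in> set ys"
      from neq[of b] b consider "position ys b < position ys (opp T b)"
        | "position ys (opp T b) < position ys b" by blast
      then show "?h (opp T b) \<le> ?h b + 1 \<and> (position ys b < position ys (opp T b) \<longrightarrow> ?h (opp T b) \<le> ?h b)"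
      proof cases
        case 1
        then show ?thesis using L[rule_format, of "opp T b"] b white[of b] p(7)[of b] by auto
      next
        case 2
        then show ?thesis using L[rule_format, of b] b by auto
      qed
    qed
  next
    assume R: "well_charged T ys"
    show "\<forall>y\<in>set ys. opp T y \<noteq> y \<and> position ys (opp T y) < position ys y \<longrightarrow>
      (if white T y then 0 \<le> ?h (opp T y) - ?h y else ?h (opp T y) - ?h y \<le> 1)"
    proof (intro ballI impI)
      fix y assume y: "y \<in> set ys" "opp T y \<noteq> y \<and> position ys (opp T y) < position ys y"
      have oy: "opp T y \<in> set ys" using y(1) p(12) D by simp
      show "if white T y then 0 \<le> ?h (opp T y) - ?h y else ?h (opp T y) - ?h y \<le> 1"
      proof (cases "white T y")
        case True
        then show ?thesis
          using R[unfolded well_charged_def, rule_format, of "opp T y"] y oy white[of y] p(7)[of y] by auto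
      next
        case False
        then show ?thesis
          using R[unfolded well_charged_def, rule_format, of y] y oy by auto
      qed
    qed
  qed
  finally show ?thesis .
qed

section \<open>Heights under a detachment, and the invariant of the greedy opening\<close>

section \<open>Opening greedily\<close>

lemma position_split_cases:
  assumes "distinct (A @ b # C)"
  shows "x \<in> set A \<Longrightarrow> position (A @ b # C) x < length A"
    "x \<in> set C \<Longrightarrow> position (A @ b # C) x = length A + 1 + position C x"
    "x \<in> set A \<Longrightarrow> height w (A @ b # C) x = height w A x"
    "x \<in> set A \<Longrightarrow> position (A @ b # C) x = position A x"
    "x \<in> set C \<Longrightarrow> height w (A @ b # C) x = sum_list (map w A) + w b + height w C x"
proof -
  show *: "position (A @ b # C) x = position A x" "height w (A @ b # C) x = height w A x" if "x \<in> set A"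
    using that by (simp_all add: position_def height_def)
  show "position (A @ b # C) x < length A" if "x \<in> set A"
  proof -
    obtain A1 A2 where "A = A1 @ x # A2" "x \<notin> set A1"
      using split_list_first[of x A] \<open>x \<in> set A\<close> by blast
    then show ?thesis
      using *(1)[OF that] by (simp add: position_def takeWhile_split)
  qed
  show "position (A @ b # C) x = length A + 1 + position C x"
    "height w (A @ b # C) x = sum_list (map w A) + w b + height w C x" if "x \<in> set C"
  proof -
    have "takeWhile (\<lambda>z. z \<noteq> x) (A @ b # C) = A @ b # takeWhile (\<lambda>z. z \<noteq> x) C"
      using that assms by (subst takeWhile_append2) auto
    then show "position (A @ b # C) x = length A + 1 + position C x"
      "height w (A @ b # C) x = sum_list (map w A) + w b + height w C x"
      by (simp_all add: position_def height_def)
  qed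
qed

lemma sum_list_map_eq_0:
  fixes w :: "'a \<Rightarrow> int"
  shows "(\<And>x. x \<in> set X \<Longrightarrow> w x = 0) \<Longrightarrow> sum_list (map w X) = 0"
  by (induction X) auto

lemma height_cong:
  assumes "\<And>z. z \<in> set ys \<Longrightarrow> w z = w' z" shows "height w ys x = height w' ys x"
  unfolding height_def using assms by (metis (mono_tags, lifting) map_cong set_takeWhileD)

context surgery
begin

lemma weight_P':
  assumes "planar_map P"
  shows "weight P' b = 1" "weight P' l = -1" "weight P b = 0"
    "x \<noteq> b \<Longrightarrow> x \<noteq> l \<Longrightarrow> weight P' x = weight P x"
    "x \<in> set F \<Longrightarrow> weight P' x = 0"
proof -
  note lb = leaves_buds[OF assms]
  have half: "x \<notin> half_edges P" if "x \<in> set (F @ [l])" for x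
    using outer_half_edges[OF assms outP] disj that by blast
  show "weight P' b = 1" "weight P b = 0"
    using lb oppP neq by (auto simp: weight_def leaves_def buds_def half_edges_def)
  show "weight P' l = -1"
    using lb(1) same neq color by (auto simp: weight_def buds_def)
  show *: "weight P' x = weight P x" if "x \<noteq> b" "x \<noteq> l" for x
    using lb that same by (simp add: weight_def)
  show "weight P' x = 0" if "x \<in> set F"
  proof -
    have "x \<noteq> b" "x \<noteq> l" using that outer_distinct[OF outP'] by auto
    then show ?thesis
      using *[of x] half[of x] that by (auto simp: weight_def buds_def leaves_def)
  qed
qed

text \<open>Opening gives \<open>b\<close> weight 1 and inserts \<open>F\<close>, of weight 0, and
  \<open>l\<close>, of weight -1. The changes cancel behind \<open>l\<close>, and \<open>b\<close>
  does not count towards its own height.\<close>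

lemma insert_old:
  assumes "planar_map P" "x \<in> set (A @ b # C)"
  shows "height (weight P') (A @ b # F @ l # C) x = height (weight P) (A @ b # C) x"
    "position (A @ b # F @ l # C) x =
       (if x \<in> set C then position (A @ b # C) x + length F + 1 else position (A @ b # C) x)"
proof -
  note w = weight_P'[OF assms(1)]
  have d': "distinct (A @ b # F @ l # C)" by (rule outer_distinct[OF outP'])
  then have d: "distinct (A @ b # C)" and dF: "distinct (F @ l # C)" by auto
  have "b \<notin> set A" "l \<notin> set A" "b \<notin> set C" "l \<notin> set C"
    using d' by auto
  then have eqA: "weight P' z = weight P z" if "z \<in> set A \<union> set C" for z
    using w(4)[of z] that by auto
  then have "map (weight P') A = map (weight P) A" by simp
  then have sumA: "sum_list (map (weight P') A) = sum_list (map (weight P) A)" by (rule arg_cong)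
  consider "x \<in> set A" "x \<notin> set C" | "x = b" "x \<notin> set C" | "x \<in> set C"
    using assms(2) d by auto
  then have "height (weight P') (A @ b # F @ l # C) x = height (weight P) (A @ b # C) x \<and>
    position (A @ b # F @ l # C) x =
       (if x \<in> set C then position (A @ b # C) x + length F + 1 else position (A @ b # C) x)"
  proof cases
    case 1
    have "height (weight P') A x = height (weight P) A x"
      by (rule height_cong) (use eqA in simp)
    then show ?thesis
      using 1 by (simp add: position_split_cases(3,4)[OF d] position_split_cases(3,4)[OF d'])
  next
    case 2
    then show ?thesis
      using height_position_split[OF d] height_position_split[OF d'] sumA by simp
  next
    case 3
    then have "height (weight P') (A @ b # F @ l # C) x =
        sum_list (map (weight P) A) + 1 + height (weight P') (F @ l # C) x"
      using position_split_cases(5)[OF d', of x] sumA w(1) by simp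
    also have "height (weight P') (F @ l # C) x =
        sum_list (map (weight P') F) - 1 + height (weight P) C x"
    proof -
      have "height (weight P') C x = height (weight P) C x"
        by (rule height_cong) (use eqA in simp)
      then show ?thesis
        using position_split_cases(5)[OF dF 3] w(2) by simp
    qed
    also have "sum_list (map (weight P') F) = 0"
      using w(5) by (intro sum_list_map_eq_0) auto
    finally have "height (weight P') (A @ b # F @ l # C) x = height (weight P) (A @ b # C) x"
      using position_split_cases(5)[OF d 3] w(3) by simp
    then show ?thesis
      using 3 position_split_cases(2)[OF d 3] position_split_cases(2)[OF dF 3]
        position_split_cases(2)[OF d', of x] by simp
  qed
  then show "height (weight P') (A @ b # F @ l # C) x = height (weight P) (A @ b # C) x"
    "position (A @ b # F @ l # C) x =
       (if x \<in> set C then position (A @ b # C) x + length F + 1 else position (A @ b # C) x)"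
    by auto
qed

text \<open>The uncovered darts follow the new bud, and no half-edge comes before \<open>l\<close>,
  whose own weight is not yet included. So the whole face appears at one level, immediately behind
  \<open>b\<close>.\<close>

lemma insert_new:
  assumes "planar_map P" "x \<in> set (F @ [l])"
  shows "height (weight P') (A @ b # F @ l # C) x = height (weight P) (A @ b # C) b + 1"
    "position (A @ b # C) b < position (A @ b # F @ l # C) x"
    "position (A @ b # F @ l # C) x \<le> position (A @ b # C) b + length F + 1"
proof -
  note w = weight_P'[OF assms(1)]
  have d': "distinct (A @ b # F @ l # C)" by (rule outer_distinct[OF outP'])
  then have d: "distinct (A @ b # C)" and dF: "distinct (F @ l # C)" by auto
  have "b \<notin> set A" "l \<notin> set A"
    using d' by auto
  then have "map (weight P') A = map (weight P) A"
    using w(4) by (metis map_cong)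
  then have sumA: "sum_list (map (weight P') A) = sum_list (map (weight P) A)" by (rule arg_cong)
  have x: "x \<in> set (F @ l # C)" using assms(2) by auto
  have "set (takeWhile (\<lambda>z. z \<noteq> x) (F @ l # C)) \<subseteq> set F"
  proof (cases "x \<in> set F")
    case True
    then show ?thesis by (auto dest: set_takeWhileD)
  next
    case False
    then show ?thesis using assms(2) takeWhile_split[of x F C] by simp
  qed
  then have "height (weight P') (F @ l # C) x = 0"
    using w(5) unfolding height_def by (intro sum_list_map_eq_0) auto
  then show "height (weight P') (A @ b # F @ l # C) x = height (weight P) (A @ b # C) b + 1"
    using position_split_cases(5)[OF d' x] height_position_split[OF d] sumA w(1) by simp
  have pF: "position (F @ l # C) x \<le> length F"
  proof (cases "x \<in> set F")
    case True
    then show ?thesis using position_split_cases(1)[OF dF, of x] by simp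
  next
    case False
    then show ?thesis using assms(2) height_position_split(2)[OF dF] by simp
  qed
  show "position (A @ b # C) b < position (A @ b # F @ l # C) x"
    "position (A @ b # F @ l # C) x \<le> position (A @ b # C) b + length F + 1"
    using pF position_split_cases(2)[OF d' x] height_position_split(2)[OF d] by auto
qed

lemma position_P':
  assumes "planar_map P" "x \<in> set (A @ b # C)"
  shows "y \<in> set (A @ b # C) \<Longrightarrow> position (A @ b # F @ l # C) x < position (A @ b # F @ l # C) y \<longleftrightarrow>
      position (A @ b # C) x < position (A @ b # C) y"
    "y \<in> set (F @ [l]) \<Longrightarrow> position (A @ b # F @ l # C) x < position (A @ b # F @ l # C) y \<longleftrightarrow>
      position (A @ b # C) x \<le> position (A @ b # C) b"
proof -
  have d: "distinct (A @ b # C)" by (rule outer_distinct[OF outP])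
  note pb = height_position_split(2)[OF d]
  have C: "z \<in> set C \<longleftrightarrow> length A < position (A @ b # C) z" if z: "z \<in> set (A @ b # C)" for z
  proof -
    consider "z \<in> set A" "z \<notin> set C" | "z = b" "z \<notin> set C" | "z \<in> set C"
      using z d by auto
    then show ?thesis
      by cases (use position_split_cases(1,2)[OF d, of z] pb in auto)
  qed
  show "position (A @ b # F @ l # C) x < position (A @ b # F @ l # C) y \<longleftrightarrow>
      position (A @ b # C) x < position (A @ b # C) y" if "y \<in> set (A @ b # C)"
    unfolding insert_old(2)[OF assms] insert_old(2)[OF assms(1) that] using C[OF that] C[OF assms(2)]
    by auto
  show "position (A @ b # F @ l # C) x < position (A @ b # F @ l # C) y \<longleftrightarrow>
      position (A @ b # C) x \<le> position (A @ b # C) b" if "y \<in> set (F @ [l])"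
    unfolding insert_old(2)[OF assms] using insert_new(2,3)[OF assms(1) that] C[OF assms(2)] pb
    by auto
qed

text \<open>The outer face only grows under opening, so a dart that was already outer cannot become
  cuttable later.\<close>

lemma cuttable_P':
  assumes "cuttable P' d"
  shows "d \<in> set (A @ b # C) \<Longrightarrow> cuttable P d" "d \<in> set (A @ b # C) \<or> d \<in> set (F @ [l])"
    "d \<noteq> b"
proof -
  have d: "\<not> white P d" "d \<in> set (A @ b # F @ l # C)" "opp P' d \<notin> set (A @ b # F @ l # C)"
    using assms same unfolding cuttable_def outer_orbit[OF outP'] by auto
  then show "d \<in> set (A @ b # C) \<or> d \<in> set (F @ [l])" by auto
  show "d \<noteq> b" using d(3) oppP' by auto
  moreover have "d \<noteq> l" using d(1) color by auto
  ultimately have "opp P d \<notin> set (A @ b # C)" using d(3) opp_other[of d] by auto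
  then show "cuttable P d" if "d \<in> set (A @ b # C)"
    using that d(1) unfolding cuttable_def outer_orbit[OF outP] by blast
qed

end

definition lex_below :: "rooted_map \<Rightarrow> nat list \<Rightarrow> nat \<Rightarrow> nat \<Rightarrow> bool" where
  "lex_below P ys x y \<longleftrightarrow> height (weight P) ys x < height (weight P) ys y \<or>
     height (weight P) ys x = height (weight P) ys y \<and> position ys x \<le> position ys y"

lemma lex_min_cuttable:
  assumes "outer P ys" "cuttable P c"
  obtains b where "cuttable P b" "\<And>d. cuttable P d \<Longrightarrow> lex_below P ys b d"
proof -
  let ?h = "height (weight P) ys"
  define K where "K = {b. cuttable P b}"
  have "K \<subseteq> set ys" unfolding K_def cuttable_def outer_orbit[OF assms(1)] by auto
  then have "finite K" "K \<noteq> {}"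
    using assms(2) finite_subset by (auto simp: K_def)
  define m where "m = Min (?h ` K)"
  have m: "m \<in> ?h ` K" "\<And>d. d \<in> K \<Longrightarrow> m \<le> ?h d"
    using \<open>finite K\<close> \<open>K \<noteq> {}\<close> by (auto simp: m_def)
  then obtain c0 where "c0 \<in> K \<and> ?h c0 = m" by auto
  then obtain b where b: "b \<in> K \<and> ?h b = m" "\<And>d. d \<in> K \<and> ?h d = m \<Longrightarrow> position ys b \<le> position ys d"
    using ex_has_least_nat[of "\<lambda>d. d \<in> K \<and> ?h d = m" c0 "position ys"] by blast
  have "lex_below P ys b d" if "d \<in> K" for d
    using b m(2)[OF that] that by (auto simp: lex_below_def)
  then show ?thesis
    using that[of b] b(1) unfolding K_def by blast
qed

text \<open>The last clause protects edges whose white side is outer before their black side. When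
  the black side is uncovered, it arrives one level above the dart being cut, and by this clause the
  white side is no higher.\<close>

definition openable :: "rooted_map \<Rightarrow> nat list \<Rightarrow> bool" where
  "openable P ys \<longleftrightarrow> rooted_at_leaf P \<and> outer P ys \<and> well_charged P ys \<and>
     (\<forall>x\<in>set ys. \<forall>b. cuttable P b \<longrightarrow> height (weight P) ys x \<le> height (weight P) ys b + 1)"

lemma openable_step:
  assumes "openable P ys" "cuttable P c"
  shows "\<exists>P' ys'. closes P' P \<and> openable P' ys'"
proof -
  from assms have P: "planar_map P" "white P (root_dart P)" "rooted_at_leaf P" and ys: "outer P ys"
    and wc: "well_charged P ys"
    and low: "\<And>x b. x \<in> set ys \<Longrightarrow> cuttable P b \<Longrightarrow> height (weight P) ys x \<le> height (weight P) ys b + 1"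
    by (auto simp: openable_def rooted_at_leaf_def)
  obtain b where b: "cuttable P b" and min: "\<And>d. cuttable P d \<Longrightarrow> lex_below P ys b d"
    using lex_min_cuttable[OF ys assms(2)] by metis
  obtain A F C where ys_eq: "ys = A @ b # C" and "surgery P (detach P b) A F C b (opp P b)"
    using surgery_detach[OF P(1,2) ys b] .
  define P' l where "P' = detach P b" "l = opp P b"
  then interpret surgery P P' A F C b l
    using \<open>surgery P (detach P b) A F C b (opp P b)\<close> by simp
  let ?h = "height (weight P) ys"
  define ys' where "ys' = A @ b # F @ l # C"
  let ?h' = "height (weight P') ys'"
  have set_ys': "x \<in> set ys' \<longleftrightarrow> x \<in> set ys \<or> x \<in> set (F @ [l])" for x
    by (auto simp: ys'_def ys_eq)
  have old: "?h' x = ?h x" if "x \<in> set ys" for x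
    using insert_old(1)[OF P(1)] that by (simp add: ys'_def ys_eq)
  have new: "?h' x = ?h b + 1" if "x \<in> set (F @ [l])" for x
    using insert_new(1)[OF P(1) that] by (simp add: ys'_def ys_eq)
  have pos: "position ys' x < position ys' y \<longleftrightarrow> position ys x < position ys y"
    if "x \<in> set ys" "y \<in> set ys" for x y
    using position_P'(1)[OF P(1)] that by (simp add: ys'_def ys_eq)
  have pos_new: "position ys' x < position ys' y \<longleftrightarrow> position ys x \<le> position ys b"
    if "x \<in> set ys" "y \<in> set (F @ [l])" for x y
    using position_P'(2)[OF P(1) _ that(2)] that(1) by (simp add: ys'_def ys_eq)
  have b_ys: "b \<in> set ys" by (simp add: ys_eq)
  have notin: "x \<notin> set ys" if "x \<in> set (F @ [l])" for x
    using that disj ys_eq by blast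
  have closes: "closes P' P"
    unfolding closes_iff_cuttable using P(3) b P'_l_def(1) by blast
  moreover have "well_charged P' ys'"
    unfolding well_charged_def
  proof (intro ballI impI)
    fix d assume d: "d \<in> set ys'" "\<not> white P' d \<and> opp P' d \<noteq> d \<and> opp P' d \<in> set ys'"
    then have d': "\<not> white P d" "d \<noteq> b" "d \<noteq> l" "opp P d = opp P' d" "opp P d \<noteq> d"
    proof -
      show "\<not> white P d" "d \<noteq> b" "d \<noteq> l"
        using d(2) oppP' same(3) by auto
      then show "opp P d = opp P' d" "opp P d \<noteq> d"
        using d(2) opp_other[of d] by auto
    qed
    show "?h' (opp P' d) \<le> ?h' d + 1 \<and>
        (position ys' d < position ys' (opp P' d) \<longrightarrow> ?h' (opp P' d) \<le> ?h' d)"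
    proof (cases "d \<in> set ys")
      case dold: True
      show ?thesis
      proof (cases "opp P d \<in> set ys")
        case True
        then show ?thesis
          using wc[unfolded well_charged_def, rule_format, of d] dold d' old pos by simp
      next
        case False
        then have n: "opp P' d \<in> set (F @ [l])"
          using d(2) set_ys' d'(4) by auto
        have "cuttable P d"
          using dold False d'(1) unfolding cuttable_def outer_orbit[OF ys] by simp
        then have lb: "lex_below P ys b d" by (rule min)
        \<comment> \<open>At equal height minimality would put \<open>b\<close> no later than
          \<open>d\<close>; both orders together give equal positions, hence \<open>d = b\<close>,
          which is excluded. The strict inequality absorbs the level gained by the uncovered white
          side.\<close>
        have "?h b < ?h d" if "position ys d \<le> position ys b"
          using lb that position_inj[OF dold b_ys] d'(2) unfolding lex_below_def by force
        moreover have "?h b \<le> ?h d"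
          using lb unfolding lex_below_def by auto
        ultimately show ?thesis
          using old[OF dold] new[OF n] pos_new[OF dold n] by auto
      qed
    next
      case False
      then have n: "d \<in> set (F @ [l])" using d(1) set_ys' by auto
      show ?thesis
      proof (cases "opp P' d \<in> set ys")
        \<comment> \<open>Here the black side is new and the white side old, the case for which the
          last clause of \<open>openable\<close> is kept.\<close>
        case True
        then show ?thesis using low[OF True b] old[OF True] new[OF n] by simp
      next
        case False
        then have "opp P' d \<in> set (F @ [l])" using d(2) set_ys' by auto
        then show ?thesis using new n by simp
      qed
    qed
  qed
  moreover have "?h' x \<le> ?h' d + 1" if x: "x \<in> set ys'" and d: "cuttable P' d" for x d
  proof -
    \<comment> \<open>The bound is renewed because \<open>b\<close> was lowest: no outer dart
      exceeds its height by more than 1, and no edge still to be opened has its black side below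
      it.\<close>
    have hx: "?h' x \<le> ?h b + 1"
      using x low[OF _ b] old new by (metis order_refl set_ys')
    show ?thesis
    proof (cases "d \<in> set ys")
      case True
      then have cd: "cuttable P d" using cuttable_P'(1)[OF d] ys_eq by simp
      have "?h b \<le> ?h d" using min[OF cd] unfolding lex_below_def by auto
      then show ?thesis using hx old[OF True] by simp
    next
      case False
      then have "d \<in> set (F @ [l])" using cuttable_P'(2)[OF d] ys_eq by blast
      then show ?thesis using hx new by simp
    qed
  qed
  moreover have "rooted_at_leaf P'"
    using planar_P'[OF P(1)] P(2) same by (simp add: rooted_at_leaf_def)
  moreover have "outer P' ys'"
    using outP' by (simp add: ys'_def)
  ultimately show ?thesis
    unfolding openable_def by blast
qed

lemma closes_card_faces:
  assumes "closes P' P" shows "card (faces P) = card (faces P') + 1"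
proof -
  from assms obtain A b F l C where s: "surgery P P' A F C b l" "b \<in> buds P'" "l \<in> leaves P'"
    "rooted_at_leaf P"
    by (rule closesE)
  interpret surgery P P' A F C b l by (rule s(1))
  have "planar_map P" using s(4) by (simp add: rooted_at_leaf_def)
  note p = planar_mapD[OF this]
  have "b \<in> darts P" "l \<in> darts P"
    using p(10)[of b] p(10)[of l] oppP neq by auto
  then show ?thesis
    using counts(1)[OF p(4,1)] p(7) by blast
qed

text \<open>The outer face is closed under crossing edges from black sides. Suppose it contains a
  white side \<open>d\<close>. Its successor lies at the black vertex across the edge, and crossing
  there and following the contour once more gives the next dart of that vertex. Turning fully around
  reaches \<open>opp P d\<close>. By connectivity the outer face is then everything.\<close>

lemma no_cuttable_tree:
  assumes "rooted_at_leaf P" "\<And>b. \<not> cuttable P b"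
  shows "tree P"
proof -
  have P: "planar_map P" using assms(1) by (simp add: rooted_at_leaf_def)
  note p = planar_mapD[OF P]
  obtain ys where ys: "outer P ys" using outer_exists[OF P] .
  have sub: "set ys \<subseteq> darts P" by (rule outer_darts[OF P ys])
  have c: "contour P d \<in> set ys" if "d \<in> set ys" for d
    using that cyc_mem[of "contour P" ys d] ys by (simp add: outer_def)
  have black: "opp P d \<in> set ys" if "d \<in> set ys" "\<not> white P d" for d
    using assms(2)[of d] that by (simp add: cuttable_def outer_orbit[OF ys])
  have opp: "opp P d \<in> set ys" if d: "d \<in> set ys" for d
  proof (cases "white P d \<and> opp P d \<noteq> d")
    case True
    let ?x = "opp P d"
    have x: "?x \<in> darts P" "\<not> white P ?x"
      using True d sub p(9)[of d] p(12)[of d] by auto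
    have "z \<in> set ys \<and> z \<in> darts P \<and> \<not> white P z" if "z \<in> orbit (rot P) ?x" for z
      using that
    proof induction
      case base
      have "rot P ?x = contour P d" by (simp add: contour_def)
      then show ?case using c[OF d] x p(8)[OF x(1)] p(11)[OF x(1)] by simp
    next
      case (step z)
      have "rot P z = contour P (opp P z)" using p(7) by (simp add: contour_def)
      moreover have "opp P z \<in> set ys" using black step.IH by blast
      ultimately show ?case using c[of "opp P z"] step.IH p(8)[of z] p(11)[of z] by simp
    qed
    moreover have "permutation (rot P)" using p(1,2) permutation_permutes by blast
    note permutation_self_in_orbit[OF this, of ?x]
    ultimately show ?thesis by blast
  qed (use d black in auto)
  have rot: "rot P d \<in> set ys" if "d \<in> set ys" for d
    using c[OF opp[OF that]] p(7) by (simp add: contour_def)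
  have "e \<in> set ys" if "(\<lambda>x y. y = rot P x \<or> y = opp P x)\<^sup>*\<^sup>* (root_dart P) e" for e
    using that
  proof induction
    case base
    then show ?case using outer_root[OF ys] by simp
  next
    case (step u v)
    then show ?case using opp rot by metis
  qed
  then have D: "darts P = set ys"
    using p(13) sub unfolding reachable_def by blast
  then show ?thesis
    using outer_darts_tree[OF P ys] by simp
qed

text \<open>Each detachment merges an inner face into the outer one, so the number of faces
  decreases until a tree is left.\<close>

lemma opening_exists:
  assumes "openable P ys"
  shows "\<exists>T xs. closes\<^sup>*\<^sup>* T P \<and> openable T xs \<and> tree T"
  using assms
proof (induction "card (faces P)" arbitrary: P ys rule: less_induct)
  case less
  show ?case
  proof (cases "\<exists>c. cuttable P c")
    case True
    then obtain P' ys' where P': "closes P' P" "openable P' ys'"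
      using openable_step[OF less.prems] by blast
    then obtain T xs where "closes\<^sup>*\<^sup>* T P'" "openable T xs" "tree T"
      using less.hyps[of P' ys'] closes_card_faces[OF P'(1)] by auto
    then show ?thesis using P'(1) by (meson rtranclp.rtrancl_into_rtrancl)
  next
    case False
    then have "tree P"
      using no_cuttable_tree less.prems by (simp add: openable_def)
    then show ?thesis using less.prems by blast
  qed
qed

lemma leg_map_openable:
  assumes "leg_map 2 M" "outer M ys"
  shows "openable M ys"
proof -
  have M: "planar_map M" "card (leaves M) = 2" "buds M = {}" "root_dart M \<in> leaves M"
    using assms(1) by (auto simp: leg_map_def)
  then have root: "rooted_at_leaf M"
    by (simp add: rooted_at_leaf_def leaves_def)
  have d: "distinct ys" by (rule outer_distinct[OF assms(2)])
  have "card (leaves M - {root_dart M}) = 1"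
    using M by simp
  then obtain s where s: "leaves M - {root_dart M} = {s}"
    using card_1_singletonE by blast
  then have w: "weight M x = (if x = s then -1 else 0)" for x
    using M(3) by (auto simp: weight_def)
  \<comment> \<open>Only the second leg \<open>s\<close> has a nonzero weight, and a distinct list
    meets it at most once.\<close>
  have low: "-1 \<le> sum_list (map (weight M) X)" if "distinct X" for X
  proof -
    have "sum_list (map (weight M) X) = (\<Sum>x\<in>set X. if x = s then -1 else 0)"
      using that by (simp add: sum_list_distinct_conv_sum_set w)
    then show ?thesis by simp
  qed
  have neg: "sum_list (map (weight M) X) \<le> 0" for X
    by (induction X) (auto simp: w)
  have h: "-1 \<le> height (weight M) ys x" "height (weight M) ys x \<le> 0" for x
    using low[OF distinct_takeWhile[OF d]] neg by (auto simp: height_def)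
  have anti: "height (weight M) ys y \<le> height (weight M) ys x"
    if "position ys x < position ys y" "x \<in> set ys" "y \<in> set ys" for x y
  proof -
    from split_list_position[OF that(2,3,1) d]
    obtain A B C where ys: "ys = A @ x # B @ y # C" .
    have "distinct ((A @ x # B) @ y # C)" using d ys by simp
    then have "height (weight M) ys y = sum_list (map (weight M) (A @ x # B))"
      using height_position_split(1)[of "A @ x # B" y C] ys by simp
    moreover have "height (weight M) ys x = sum_list (map (weight M) A)"
      using height_position_split(1)[of A x "B @ y # C"] ys d by simp
    ultimately show ?thesis
      using neg[of "x # B"] by simp
  qed
  have *: "height (weight M) ys x \<le> height (weight M) ys y + 1" for x y
    using h(1)[of y] h(2)[of x] by linarith
  show ?thesis
    unfolding openable_def well_charged_def using root assms(2) * anti by blast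
qed

section \<open>Rigidity of the opening\<close>

section \<open>Uniqueness of the opening\<close>

lemma closes_opp:
  assumes "closes\<^sup>*\<^sup>* T P" shows "opp T x = opp P x \<or> opp T x = x"
  using assms
proof induction
  case (step P' P)
  from step(2) obtain A b F l C where s: "surgery P P' A F C b l"
    by (rule closesE)
  interpret surgery P P' A F C b l by (rule s)
  show ?case using step.IH oppP' opp_other by metis
qed simp

text \<open>Heights and order of outer darts are already final when the darts appear, so the
  condition on the tree can be tested against data of any intermediate stage.\<close>

lemma closes_heights:
  assumes "closes\<^sup>*\<^sup>* T P" "outer T xs" "outer P ys"
  shows "set ys \<subseteq> set xs"
    "x \<in> set ys \<Longrightarrow> height (weight T) xs x = height (weight P) ys x"
    "x \<in> set ys \<Longrightarrow> y \<in> set ys \<Longrightarrow> position xs x < position xs y \<longleftrightarrow> position ys x < position ys y"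
proof -
  have "\<forall>ys. outer P ys \<longrightarrow> set ys \<subseteq> set xs \<and>
     (\<forall>x\<in>set ys. height (weight T) xs x = height (weight P) ys x) \<and>
     (\<forall>x\<in>set ys. \<forall>y\<in>set ys. position xs x < position xs y \<longleftrightarrow> position ys x < position ys y)"
    using assms(1)
  proof induction
    case base
    then show ?case using outer_unique[OF assms(2)] by auto
  next
    case (step P' P)
    from step(2) obtain A b F l C where s: "surgery P P' A F C b l" "rooted_at_leaf P"
      by (rule closesE)
    interpret surgery P P' A F C b l by (rule s)
    have P: "planar_map P" using s(2) by (simp add: rooted_at_leaf_def)
    have sub: "set (A @ b # C) \<subseteq> set (A @ b # F @ l # C)" by auto
    note IH = step.IH[rule_format, OF outP']
    show ?case
    proof (intro allI impI)
      fix ys assume "outer P ys"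
      then have ys: "ys = A @ b # C" using outer_unique outP by blast
      have "set ys \<subseteq> set xs"
        using IH sub by (auto simp: ys)
      moreover have "height (weight T) xs x = height (weight P) ys x" if "x \<in> set ys" for x
        using IH that sub insert_old(1)[OF P, of x] by (auto simp: ys)
      moreover have "position xs x < position xs y \<longleftrightarrow> position ys x < position ys y"
        if "x \<in> set ys" "y \<in> set ys" for x y
        using IH that sub position_P'(1)[OF P, of x y] by (auto simp: ys)
      ultimately show "set ys \<subseteq> set xs \<and>
        (\<forall>x\<in>set ys. height (weight T) xs x = height (weight P) ys x) \<and>
        (\<forall>x\<in>set ys. \<forall>y\<in>set ys. position xs x < position xs y \<longleftrightarrow> position ys x < position ys y)"
        by blast
    qed
  qed
  then show "set ys \<subseteq> set xs"
    "x \<in> set ys \<Longrightarrow> height (weight T) xs x = height (weight P) ys x"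
    "x \<in> set ys \<Longrightarrow> y \<in> set ys \<Longrightarrow> position xs x < position xs y \<longleftrightarrow> position ys x < position ys y"
    using assms(3) by blast+
qed

text \<open>A dart is uncovered one level above some cuttable \<open>b'\<close>. If \<open>b\<close>
  is lexicographically no later than \<open>b'\<close>, the dart is at least one level above
  \<open>b\<close>, and in case of equality it comes behind \<open>b\<close>. Darts that become
  cuttable lie strictly above \<open>b\<close>, so \<open>b\<close> stays minimal
  throughout.\<close>

lemma lex_below_later:
  assumes "closes\<^sup>*\<^sup>* T P" "outer T xs" "outer P ys" "b \<in> set ys"
    "\<And>d. cuttable P d \<Longrightarrow> lex_below P ys b d" "w \<in> set xs" "w \<notin> set ys"
  shows "height (weight T) xs b + 1 \<le> height (weight T) xs w \<and>
    (height (weight T) xs w = height (weight T) xs b + 1 \<longrightarrow> position xs b < position xs w)"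
  using assms(1,3-5,7)
proof (induction arbitrary: ys)
  case base
  then show ?case using outer_unique[OF assms(2)] assms(6) by blast
next
  case (step P' P)
  from step(2) obtain A b' F l C where s: "surgery P P' A F C b' l" "rooted_at_leaf P"
    by (rule closesE)
  interpret surgery P P' A F C b' l by (rule s)
  have P: "planar_map P" using s(2) by (simp add: rooted_at_leaf_def)
  have ys: "ys = A @ b' # C" using outer_unique outP step.prems(1) by blast
  define ys' where "ys' = A @ b' # F @ l # C"
  have o: "outer P' ys'" using outP' by (simp add: ys'_def)
  have sub: "set ys \<subseteq> set ys'" by (auto simp: ys ys'_def)
  note H = closes_heights[OF step(1) assms(2) o]
  have old: "height (weight P') ys' x = height (weight P) ys x" if "x \<in> set ys" for x
    using insert_old(1)[OF P] that by (simp add: ys'_def ys)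
  have new: "height (weight P') ys' x = height (weight P) ys b' + 1" if "x \<in> set (F @ [l])" for x
    using insert_new(1)[OF P that] by (simp add: ys'_def ys)
  have "cuttable P b'"
    using color oppP disj by (auto simp: cuttable_def outer_orbit[OF outP])
  then have lb: "lex_below P ys b b'" by (rule step.prems(3))
  show ?case
  proof (cases "w \<in> set ys'")
    case True
    then have w: "w \<in> set (F @ [l])" using step.prems(4) by (auto simp: ys ys'_def)
    have b: "b \<in> set ys'" using step.prems(2) sub by blast
    have "position ys' b < position ys' w \<longleftrightarrow> position ys b \<le> position ys b'"
      using position_P'(2)[OF P _ w, of b] step.prems(2) by (simp add: ys ys'_def)
    then show ?thesis
      using H(2)[OF b] H(2)[OF True] H(3)[OF b True] old[OF step.prems(2)] new[OF w] lb
      unfolding lex_below_def by auto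
  next
    case False
    show ?thesis
    proof (rule step.IH[OF o _ _ False])
      show "b \<in> set ys'" using step.prems(2) sub by blast
      fix d assume d: "cuttable P' d"
      show "lex_below P' ys' b d"
      proof (cases "d \<in> set ys")
        case True
        then have "lex_below P ys b d"
          using cuttable_P'(1)[OF d] step.prems(3) ys by blast
        moreover have "position ys' d < position ys' b \<longleftrightarrow> position ys d < position ys b"
          using position_P'(1)[OF P, of d b] True step.prems(2) by (simp add: ys ys'_def)
        ultimately show ?thesis
          using old[OF True] old[OF step.prems(2)] unfolding lex_below_def by auto
      next
        case False
        then have n: "d \<in> set (F @ [l])" using cuttable_P'(2)[OF d] ys by blast
        show ?thesis
          using lb old[OF step.prems(2)] new[OF n] unfolding lex_below_def by auto
      qed
    qed
  qed
qed

text \<open>If the edge survived in \<open>T\<close>, its white side would be uncovered later. The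
  first clause of \<open>well_charged\<close> then forces it to be exactly one level above
  \<open>b\<close>, hence behind \<open>b\<close>, and this contradicts the second clause.\<close>

lemma lex_min_bud:
  assumes "closes\<^sup>*\<^sup>* T P" "outer T xs" "outer P ys" "well_charged T xs" "rooted_at_leaf T" "tree T"
    and b: "cuttable P b" and min: "\<And>d. cuttable P d \<Longrightarrow> lex_below P ys b d"
  shows "opp T b = b"
proof (rule ccontr)
  assume n: "opp T b \<noteq> b"
  have bys: "b \<in> set ys" "opp P b \<notin> set ys" "\<not> white P b"
    using b unfolding cuttable_def outer_orbit[OF assms(3)] by auto
  have opp: "opp T b = opp P b"
    using closes_opp[OF assms(1), of b] n by simp
  have D: "set xs = darts T" by (rule tree_outer_darts[OF assms(6,2)])
  have bxs: "b \<in> set xs" using closes_heights(1)[OF assms(1-3)] bys by blast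
  have T: "planar_map T" using assms(5) by (simp add: rooted_at_leaf_def)
  have wxs: "opp T b \<in> set xs" using planar_mapD(12)[OF T] bxs D by simp
  have "\<not> white T b" using bys(3) closes_preserves(4)[OF assms(1,5)] by simp
  then have "height (weight T) xs (opp T b) \<le> height (weight T) xs b + 1"
    "position xs b < position xs (opp T b) \<longrightarrow> height (weight T) xs (opp T b) \<le> height (weight T) xs b"
    using assms(4) n bxs wxs unfolding well_charged_def by blast+
  moreover have "opp T b \<notin> set ys" using bys(2) opp by simp
  note lex_below_later[OF assms(1-3) bys(1) min wxs this]
  ultimately show False by auto
qed

lemma outer_detach:
  assumes "rooted_at_leaf P" "cuttable P b"
  shows "orbit (contour (detach P b)) (root_dart P) =
    orbit (contour P) (root_dart P) \<union> orbit (contour P) (opp P b)"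
proof -
  have P: "planar_map P" "white P (root_dart P)"
    using assms(1) by (auto simp: rooted_at_leaf_def)
  obtain ys where ys: "outer P ys" using outer_exists[OF P(1)] .
  obtain A F C where "surgery P (detach P b) A F C b (opp P b)"
    using surgery_detach[OF P ys assms(2)] .
  then interpret surgery P "detach P b" A F C b "opp P b" .
  have "orbit (contour P) (opp P b) = set (F @ [opp P b])"
    by (rule cyc_orbit[OF inner]) simp
  then show ?thesis
    using outer_orbit[OF outP'] outer_orbit[OF outP] by auto
qed

text \<open>A cut needs one side off the outer face, and the outer face only grows. An edge with
  both sides on it is therefore safe for the rest of the opening.\<close>

lemma uncut_stays:
  assumes "closes\<^sup>*\<^sup>* T P" "rooted_at_leaf T" "b \<in> orbit (contour P) (root_dart P)"
    "opp P b \<in> orbit (contour P) (root_dart P)"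
  shows "opp T b = opp P b"
  using assms(1,3,4)
proof induction
  case (step P' P)
  have P: "rooted_at_leaf P"
    using closes_preserves(1)[OF _ assms(2)] step(1,2) by (meson rtranclp.rtrancl_into_rtrancl)
  obtain c where c: "cuttable P c" "P' = detach P c"
    using step(2) closes_iff_cuttable by blast
  have p: "opp P (opp P d) = d" for d
    using planar_mapD(7) P by (simp add: rooted_at_leaf_def)
  have "b \<noteq> c" "b \<noteq> opp P c"
    using c(1) step.prems by (auto simp: cuttable_def)
  then have "opp P' b = opp P b" using c(2) by simp
  then show ?case
    using step.IH step.prems outer_detach[OF P c(1)] c(2) by simp
qed simp

text \<open>An edge cut at some point of the opening can be cut first. To move its cut in front of
  that of another edge \<open>c\<close>, both must be cuttable in either order, which holds if
  different faces lie behind them.\<close>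

lemma detach_bud:
  assumes "closes\<^sup>*\<^sup>* T P" "rooted_at_leaf T" "cuttable P b" "opp T b = b"
  shows "closes\<^sup>*\<^sup>* T (detach P b)"
  using assms(1,3)
proof induction
  case base
  then show ?case using assms(4) by (auto simp: cuttable_def)
next
  case (step P1 P)
  have cl: "closes\<^sup>*\<^sup>* T P"
    using step(1,2) by (rule rtranclp.rtrancl_into_rtrancl)
  have P: "rooted_at_leaf P" "planar_map P"
    using closes_preserves(1)[OF cl assms(2)] by (auto simp: rooted_at_leaf_def)
  note p = planar_mapD[OF P(2)]
  obtain c where c: "cuttable P c" "P1 = detach P c"
    using step(2) closes_iff_cuttable by blast
  show ?case
  proof (cases "b = c")
    case True
    then show ?thesis using step(1) c(2) by simp
  next
    case False
    have white: "white P (opp P d)" if "cuttable P d" for d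
    proof -
      have "opp P d \<noteq> d" using that by (auto simp: cuttable_def)
      then show ?thesis using p(9,10)[of d] that by (auto simp: cuttable_def)
    qed
    have ne: "b \<noteq> opp P c" "c \<noteq> opp P b"
      using white[OF c(1)] white[OF step.prems] c(1) step.prems by (auto simp: cuttable_def)
    then have opp1: "opp P1 b = opp P b" using c(2) False by simp
    note o1 = outer_detach[OF P(1) c(1)] and o2 = outer_detach[OF P(1) step.prems]
    have b1: "b \<in> orbit (contour P1) (root_dart P1)"
      using step.prems o1 c(2) by (simp add: cuttable_def)
    \<comment> \<open>If the same face lay behind both edges, cutting \<open>c\<close> would bring
      \<open>opp P b\<close> to the outer face as well, and by \<open>uncut_stays\<close> the edge
      of \<open>b\<close> could not become a bud.\<close>
    have n1: "opp P b \<notin> orbit (contour P1) (root_dart P1)"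
    proof
      assume "opp P b \<in> orbit (contour P1) (root_dart P1)"
      then have "opp T b = opp P b"
        using uncut_stays[OF step(1) assms(2) b1] opp1 by simp
      then show False
        using assms(4) step.prems by (auto simp: cuttable_def)
    qed
    then have "cuttable P1 b"
      using b1 opp1 step.prems c(2) by (simp add: cuttable_def)
    then have IH: "closes\<^sup>*\<^sup>* T (detach P1 b)" by (rule step.IH)
    have perm: "permutation (contour P)"
      using p(1,4) permutation_permutes by blast
    have "opp P c \<notin> orbit (contour P) (opp P b)"
    proof
      assume "opp P c \<in> orbit (contour P) (opp P b)"
      then have "opp P b \<in> orbit (contour P) (opp P c)"
        using orbit_swap[OF permutation_self_in_orbit[OF perm]] by metis
      then show False using n1 o1 c(2) by simp
    qed
    then have "cuttable (detach P b) c"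
      using c(1) ne False o2 by (auto simp: cuttable_def)
    moreover have "rooted_at_leaf (detach P b)"
    proof -
      have "closes (detach P b) P"
        using closes_iff_cuttable P(1) step.prems by blast
      then show ?thesis by (simp add: closes_def)
    qed
    ultimately have "closes (detach (detach P b) c) (detach P b)"
      using closes_iff_cuttable by blast
    moreover have "opp P b \<noteq> opp P c" using p(7) False by metis
    then have "detach (detach P b) c = detach P1 b"
      using ne False c(2) by (auto simp: detach_def fun_eq_iff)
    ultimately show ?thesis
      using IH by (metis rtranclp.rtrancl_into_rtrancl)
  qed
qed

text \<open>Both trees have a bud at the least cuttable dart, so both openings may be rearranged to
  start with this one detachment, and the induction continues with fewer faces. Without cuttable
  darts \<open>M\<close> has no predecessor and equals both trees.\<close>

lemma opening_unique:
  assumes "closes\<^sup>*\<^sup>* T M" "closes\<^sup>*\<^sup>* T' M"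
    "rooted_at_leaf T" "tree T" "outer T xs" "well_charged T xs"
    "rooted_at_leaf T'" "tree T'" "outer T' xs'" "well_charged T' xs'"
  shows "T = T'"
  using assms(1,2)
proof (induction "card (faces M)" arbitrary: M rule: less_induct)
  case less
  have M: "rooted_at_leaf M" "planar_map M"
    using closes_preserves(1)[OF less.prems(1) assms(3)] by (auto simp: rooted_at_leaf_def)
  obtain ys where ys: "outer M ys" using outer_exists[OF M(2)] .
  show ?case
  proof (cases "\<exists>c. cuttable M c")
    case True
    then obtain b where b: "cuttable M b" "\<And>d. cuttable M d \<Longrightarrow> lex_below M ys b d"
      using lex_min_cuttable[OF ys] by metis
    have "opp T b = b" "opp T' b = b"
      using lex_min_bud[OF less.prems(1) assms(5) ys assms(6,3,4) b]
        lex_min_bud[OF less.prems(2) assms(9) ys assms(10,7,8) b] by auto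
    then have "closes\<^sup>*\<^sup>* T (detach M b)" "closes\<^sup>*\<^sup>* T' (detach M b)"
      using detach_bud[OF less.prems(1) assms(3) b(1)] detach_bud[OF less.prems(2) assms(7) b(1)] by auto
    moreover have "closes (detach M b) M"
      using closes_iff_cuttable M(1) b(1) by blast
    ultimately show ?thesis
      using less.hyps[of "detach M b"] closes_card_faces by force
  next
    case False
    then have "\<not> closes P M" for P
      using closes_iff_cuttable by blast
    then have "T = M" "T' = M"
      using less.prems by (metis rtranclp.cases)+
    then show ?thesis by simp
  qed
qed

section \<open>Transport of closings and openings along isomorphisms\<close>

section \<open>Isomorphisms\<close>

locale map_isomorphism =
  fixes h :: "nat \<Rightarrow> nat" and M N :: rooted_map
  assumes rooted: "rooted_at_leaf M" "rooted_at_leaf N"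
    and bij: "bij_betw h (darts M) (darts N)"
    and hom: "\<And>d. d \<in> darts M \<Longrightarrow> h (rot M d) = rot N (h d)"
      "\<And>d. d \<in> darts M \<Longrightarrow> h (opp M d) = opp N (h d)"
      "\<And>d. d \<in> darts M \<Longrightarrow> white N (h d) = white M d"
    and root: "h (root_dart M) = root_dart N"
begin

lemma planar: "planar_map M" "planar_map N"
  using rooted by (auto simp: rooted_at_leaf_def)

lemmas M = planar_mapD[OF planar(1)]

lemma h_inj: "d \<in> darts M \<Longrightarrow> e \<in> darts M \<Longrightarrow> h d = h e \<longleftrightarrow> d = e"
  using bij by (auto simp: bij_betw_def inj_on_eq_iff)

lemma h_darts: "d \<in> darts M \<Longrightarrow> h d \<in> darts N"
  using bij by (auto simp: bij_betw_def)

lemma h_half_edges: "d \<in> darts M \<Longrightarrow> h d \<in> half_edges N \<longleftrightarrow> d \<in> half_edges M"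
  using h_darts h_inj[of "opp M d" d] hom(2) M(12) by (auto simp: half_edges_def)

lemma h_leaves_buds:
  assumes "d \<in> darts M"
  shows "h d \<in> leaves N \<longleftrightarrow> d \<in> leaves M" "h d \<in> buds N \<longleftrightarrow> d \<in> buds M"
  using h_half_edges[OF assms] hom(3)[OF assms] by (auto simp: leaves_def buds_def)

lemma h_outer:
  assumes "outer M ys"
  shows "outer N (map h ys)"
proof -
  have ys: "set ys \<subseteq> darts M" by (rule outer_darts[OF planar(1) assms])
  have "cyc (contour N) (map h ys)"
  proof (rule cyc_map)
    show "cyc (contour M) ys" using assms by (simp add: outer_def)
    show "inj_on h (set ys)" using bij ys by (auto simp: bij_betw_def intro: inj_on_subset)
    show "h (contour M x) = contour N (h x)" if "x \<in> set ys" for x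
      using that ys hom(1)[of "opp M x"] hom(2)[of x] M(12)[of x] by (auto simp: contour_def)
  qed
  then show ?thesis
    using assms root outer_root(2)[OF assms] by (simp add: outer_def hd_map)
qed

lemma h_weight: "d \<in> darts M \<Longrightarrow> weight N (h d) = weight M d"
  using h_leaves_buds[of d] h_inj[of d "root_dart M"] M(5) root by (simp add: weight_def)

lemma h_height_position:
  assumes "set ys \<subseteq> darts M" "x \<in> darts M"
  shows "height (weight N) (map h ys) (h x) = height (weight M) ys x"
    "position (map h ys) (h x) = position ys x"
proof -
  have t: "takeWhile (\<lambda>z. z \<noteq> h x) (map h ys) = map h (takeWhile (\<lambda>z. z \<noteq> x) ys)"
  proof -
    have "takeWhile ((\<lambda>z. z \<noteq> h x) \<circ> h) ys = takeWhile (\<lambda>z. z \<noteq> x) ys"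
      using assms h_inj by (intro takeWhile_cong) auto
    then show ?thesis by (simp add: takeWhile_map)
  qed
  show "position (map h ys) (h x) = position ys x"
    by (simp add: position_def t)
  have "map (weight N) (map h (takeWhile (\<lambda>z. z \<noteq> x) ys)) = map (weight M) (takeWhile (\<lambda>z. z \<noteq> x) ys)"
    using assms(1) h_weight by (auto dest: set_takeWhileD)
  then show "height (weight N) (map h ys) (h x) = height (weight M) ys x"
    unfolding height_def t by (rule arg_cong)
qed

lemma h_well_charged:
  assumes "outer M ys" "well_charged M ys"
  shows "well_charged N (map h ys)"
  unfolding well_charged_def
proof (intro ballI impI)
  have ys: "set ys \<subseteq> darts M" by (rule outer_darts[OF planar(1) assms(1)])
  fix e assume e: "e \<in> set (map h ys)" "\<not> white N e \<and> opp N e \<noteq> e \<and> opp N e \<in> set (map h ys)"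
  then obtain d d' where d: "d \<in> set ys" "e = h d" and d': "d' \<in> set ys" "opp N e = h d'" by auto
  have D: "d \<in> darts M" "d' \<in> darts M" "opp M d \<in> darts M" using d d' ys M(12) by auto
  then have "opp M d = d'"
    using hom(2)[of d] d(2) d'(2) h_inj[of "opp M d" d'] by simp
  then have "\<not> white M d \<and> opp M d \<noteq> d \<and> opp M d \<in> set ys"
    using e(2) d d' hom(3)[OF D(1)] by auto
  then have "height (weight M) ys (opp M d) \<le> height (weight M) ys d + 1 \<and>
     (position ys d < position ys (opp M d) \<longrightarrow> height (weight M) ys (opp M d) \<le> height (weight M) ys d)"
    using assms(2) d(1) unfolding well_charged_def by blast
  then show "height (weight N) (map h ys) (opp N e) \<le> height (weight N) (map h ys) e + 1 \<and>
     (position (map h ys) e < position (map h ys) (opp N e) \<longrightarrow>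
       height (weight N) (map h ys) (opp N e) \<le> height (weight N) (map h ys) e)"
    unfolding d'(2) unfolding d(2) using \<open>opp M d = d'\<close>
    by (simp add: h_height_position[OF ys D(1)] h_height_position[OF ys D(2)])
qed

lemma h_tree:
  assumes "tree M" shows "tree N"
proof -
  obtain ys where ys: "outer M ys" using outer_exists[OF planar(1)] .
  have "set (map h ys) = darts N"
    using tree_outer_darts[OF assms ys] bij by (auto simp: bij_betw_def)
  then show ?thesis by (rule outer_darts_tree[OF planar(2) h_outer[OF ys]])
qed

lemma h_orbit:
  assumes "d \<in> darts M" shows "orbit (rot N) (h d) = h ` orbit (rot M) d"
proof -
  obtain ys where ys: "cyc (rot M) ys" "hd ys = d" using cyc_exists[OF M(2,1)] .
  then have d: "d \<in> set ys" by (auto simp: cyc_def)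
  then have sub: "set ys \<subseteq> darts M"
    using cyc_orbit[OF ys(1)] permutes_orbit_subset[OF M(2) assms] by simp
  have "cyc (rot N) (map h ys)"
    using bij sub hom(1) by (intro cyc_map[OF ys(1)]) (auto simp: bij_betw_def intro: inj_on_subset)
  from cyc_orbit[OF this, of "h d"] show ?thesis
    using cyc_orbit[OF ys(1) d] d by simp
qed

lemma h_degree_distribution: "degree_distribution N = degree_distribution M"
proof -
  have dN: "darts N = h ` darts M" using bij by (simp add: bij_betw_def)
  have "vertices N = (\<lambda>d. orbit (rot N) (h d)) ` darts M"
    unfolding vertices_def dN by (simp add: image_image)
  also have "\<dots> = (\<lambda>d. h ` orbit (rot M) d) ` darts M"
    by (rule image_cong) (auto simp: h_orbit)
  finally have v: "vertices N = (image h) ` vertices M"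
    unfolding vertices_def by (simp add: image_image)
  have sub: "v \<subseteq> darts M" if "v \<in> vertices M" for v
    using that permutes_orbit_subset[OF M(2)] unfolding vertices_def by blast
  have inj: "inj_on h v" if "v \<in> vertices M" for v
    using bij sub[OF that] by (auto simp: bij_betw_def intro: inj_on_subset)
  have injv: "inj_on (image h) (vertices M)"
    using inj_on_image_Pow[of h "darts M"] bij sub by (auto simp: bij_betw_def intro: inj_on_subset)
  have main: "image_mset card (mset_set {v \<in> vertices N. \<forall>d\<in>v. Q (white N d)}) =
      image_mset card (mset_set {v \<in> vertices M. \<forall>d\<in>v. Q (white M d)})" for Q
  proof -
    let ?V = "{v \<in> vertices M. \<forall>d\<in>v. Q (white M d)}"
    have "(\<forall>d\<in>h ` v. Q (white N d)) \<longleftrightarrow> (\<forall>d\<in>v. Q (white M d))" if "v \<in> vertices M" for v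
    proof -
      have "white N (h d) = white M d" if "d \<in> v" for d
        using that sub[OF \<open>v \<in> vertices M\<close>] hom(3) by blast
      then show ?thesis by auto
    qed
    then have "{v \<in> vertices N. \<forall>d\<in>v. Q (white N d)} = (image h) ` ?V"
      unfolding v by blast
    moreover have "mset_set ((image h) ` ?V) = image_mset (image h) (mset_set ?V)"
      using injv by (intro image_mset_mset_set[symmetric]) (auto intro: inj_on_subset)
    moreover have "image_mset (card \<circ> image h) (mset_set ?V) = image_mset card (mset_set ?V)"
    proof (rule image_mset_cong)
      fix v assume "v \<in># mset_set ?V"
      \<comment> \<open>For an infinite set \<open>mset_set\<close> is empty, so membership in the
        multiset yields membership in the set in either case.\<close>
      then have "v \<in> vertices M"
        by (metis (mono_tags, lifting) elem_mset_set infinite_set_mset_mset_set mem_Collect_eq empty_iff)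
      then show "(card \<circ> image h) v = card v"
        using card_image[OF inj] by simp
    qed
    ultimately show ?thesis by (simp add: multiset.map_comp)
  qed
  show ?thesis
    unfolding degree_distribution_def using main[of "\<lambda>x. x"] main[of Not] by simp
qed

text \<open>The darts stay the same during a step, so the same \<open>h\<close> is an isomorphism
  afterwards; this is what allows iteration along a whole closing.\<close>

lemma h_closes:
  assumes "closes M P" shows "\<exists>Q. closes N Q \<and> map_isomorphism h P Q"
proof -
  obtain A b F l C where s: "outer M (A @ b # F @ l # C)" "b \<in> buds M" "l \<in> leaves M"
    "set F \<inter> half_edges M = {}" and P: "P = glue M b l"
    using assms unfolding closes_def by blast
  have sub: "set (A @ b # F @ l # C) \<subseteq> darts M" by (rule outer_darts[OF planar(1) s(1)])
  then have D: "b \<in> darts M" "l \<in> darts M" "set F \<subseteq> darts M" by auto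
  have cN: "closes N (glue N (h b) (h l))"
  proof (rule closesI[OF rooted(2)])
    show "outer N (map h A @ h b # map h F @ h l # map h C)"
      using h_outer[OF s(1)] by simp
    show "h b \<in> buds N" "h l \<in> leaves N"
      using s(2,3) h_leaves_buds D by auto
    show "set (map h F) \<inter> half_edges N = {}"
      using s(4) h_half_edges D(3) by auto
  qed
  have "map_isomorphism h P (glue N (h b) (h l))"
  proof
    show "rooted_at_leaf P" "rooted_at_leaf (glue N (h b) (h l))"
      using closes_preserves(1)[OF r_into_rtranclp rooted(1)] assms
        closes_preserves(1)[OF r_into_rtranclp rooted(2)] cN by blast+
    show "h (opp P d) = opp (glue N (h b) (h l)) (h d)" if "d \<in> darts P" for d
      using that hom(2)[of d] h_inj[of d b] h_inj[of d l] D unfolding P by simp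
  qed (use bij hom root P in auto)
  then show ?thesis using cN by blast
qed

lemma h_opens:
  assumes "closes P M" shows "\<exists>Q. closes Q N \<and> map_isomorphism h P Q"
proof -
  obtain b where b: "cuttable M b" and P: "P = detach M b"
    using assms closes_iff_cuttable by blast
  obtain ys where ys: "outer M ys" using outer_exists[OF planar(1)] .
  have sub: "set ys \<subseteq> darts M" by (rule outer_darts[OF planar(1) ys])
  have b': "\<not> white M b" "b \<in> set ys" "opp M b \<notin> set ys"
    using b unfolding cuttable_def outer_orbit[OF ys] by auto
  then have D: "b \<in> darts M" "opp M b \<in> darts M" using sub M(12) by auto
  have "h (opp M b) \<notin> set (map h ys)"
    using b'(3) h_inj[OF D(2)] sub by auto
  then have "cuttable N (h b)"
    unfolding cuttable_def outer_orbit[OF h_outer[OF ys]]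
    using b' D hom(2,3)[OF D(1)] by simp
  then have cN: "closes (detach N (h b)) N"
    using closes_iff_cuttable rooted(2) by blast
  have "map_isomorphism h P (detach N (h b))"
  proof
    show "rooted_at_leaf P" "rooted_at_leaf (detach N (h b))"
      using assms cN by (auto simp: closes_def)
    show "h (opp P d) = opp (detach N (h b)) (h d)" if "d \<in> darts P" for d
      using that hom(2)[of d] hom(2)[OF D(1)] h_inj[of d b] h_inj[of d "opp M b"] D unfolding P
      by simp
  qed (use bij hom root P in auto)
  then show ?thesis using cN by blast
qed

end

lemma iso_closes:
  assumes "closes\<^sup>*\<^sup>* T P" "map_isomorphism h T T'"
  shows "\<exists>P'. closes\<^sup>*\<^sup>* T' P' \<and> map_isomorphism h P P'"
  using assms(1)
proof induction
  case base
  then show ?case using assms(2) by blast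
next
  case (step P Q)
  then show ?case
    using map_isomorphism.h_closes by (meson rtranclp.rtrancl_into_rtrancl)
qed

lemma iso_opens:
  assumes "closes\<^sup>*\<^sup>* T P" "map_isomorphism h P P'"
  shows "\<exists>T'. closes\<^sup>*\<^sup>* T' P' \<and> map_isomorphism h T T'"
  using assms
proof (induction arbitrary: P')
  case base
  then show ?case by blast
next
  case (step Q P)
  then obtain Q' where "closes Q' P'" "map_isomorphism h Q Q'"
    using map_isomorphism.h_opens by blast
  then show ?case
    using step.IH by (meson rtranclp.rtrancl_into_rtrancl)
qed

lemma map_iso_iff:
  assumes "rooted_at_leaf M" "rooted_at_leaf N"
  shows "(M, N) \<in> map_iso \<longleftrightarrow> (\<exists>h. map_isomorphism h M N)"
proof -
  have "planar_map M" "planar_map N"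
    using assms by (auto simp: rooted_at_leaf_def)
  then have "(M, N) \<in> map_iso \<longleftrightarrow> isomorphic M N"
    by (simp add: map_iso_def)
  also have "\<dots> \<longleftrightarrow> (\<exists>h. map_isomorphism h M N)"
    unfolding isomorphic_def map_isomorphism_def using assms by blast
  finally show ?thesis .
qed

lemma map_iso_rooted_at_leaf:
  assumes "(M, N) \<in> map_iso" "rooted_at_leaf M" shows "rooted_at_leaf N"
proof -
  have N: "planar_map N" "planar_map M" and "isomorphic M N" using assms(1) by (auto simp: map_iso_def)
  then obtain h where "h (root_dart M) = root_dart N"
    "\<And>d. d \<in> darts M \<Longrightarrow> white N (h d) = white M d"
    unfolding isomorphic_def by blast
  then have "white N (root_dart N)"
    using planar_mapD(5)[OF N(2)] assms(2) by (metis rooted_at_leaf_def)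
  then show ?thesis using N(1) by (simp add: rooted_at_leaf_def)
qed

section \<open>Balanced blossom trees against two-leg maps, up to isomorphism\<close>

section \<open>The bijection\<close>

lemma unmatched_half_edges: "unmatched T R \<Longrightarrow> R \<subseteq> half_edges T"
  by (induction rule: unmatched.induct) auto

text \<open>Behind the last remaining bud the next remaining half-edge is a leaf, possibly the root
  reached by going around, so the bud could still be matched. An unmatched root thus guarantees that
  all buds get used.\<close>

lemma final_unmatched_no_buds:
  assumes "rooted_at_leaf T" "unmatched T R" "root_dart T \<in> R" "\<nexists>b l. matchable T R b l"
  shows "R \<inter> buds T = {}"
proof (rule ccontr)
  assume "R \<inter> buds T \<noteq> {}"
  then obtain b0 where b0: "b0 \<in> R" "b0 \<in> buds T" by blast
  have T: "planar_map T" "white T (root_dart T)"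
    using assms(1) by (auto simp: rooted_at_leaf_def)
  have half: "R \<subseteq> half_edges T" by (rule unmatched_half_edges[OF assms(2)])
  obtain xs where xs: "outer T xs" using outer_exists[OF T(1)] .
  have "b0 \<in> set xs"
    using b0(1) half outer_half_edges[OF T(1) xs] by blast
  then have "\<exists>x\<in>set xs. x \<in> R \<inter> buds T" using b0 by blast
  then obtain A b C where split: "xs = A @ b # C" "b \<in> R \<inter> buds T" "\<forall>x\<in>set C. x \<notin> R \<inter> buds T"
    using split_list_last_prop[of xs "\<lambda>x. x \<in> R \<inter> buds T"] by metis
  have cyc: "cyc (contour T) xs" "hd xs = root_dart T" using xs by (auto simp: outer_def)
  have d: "distinct xs" by (rule outer_distinct[OF xs])
  have A: "A \<noteq> []"
    using split T(2) cyc(2) by (auto simp: buds_def)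
  have leaf: "l \<in> leaves T" if "l \<in> R" "l \<notin> buds T" for l
    using that half by (auto simp: leaves_def buds_def)
  show False
  proof (cases "\<exists>x\<in>set C. x \<in> R")
    case True
    then obtain F l D where C: "C = F @ l # D" "l \<in> R" "\<forall>x\<in>set F. x \<notin> R"
      using split_list_first_prop[of C "\<lambda>x. x \<in> R"] by metis
    have "l \<noteq> hd xs"
      using A d C(1) split(1) by (cases A) auto
    have "next_in T R b l"
      unfolding next_in_def
      by (rule cyc_first_hit[THEN iffD2, OF cyc(1) _ _ \<open>l \<noteq> hd xs\<close>])
        (use cyc(2) assms(3) split(1) C in auto)
    moreover have "l \<in> leaves T"
      using leaf C(1,2) split(3) by auto
    ultimately show False
      using assms(4) split(2) C(2) by (auto simp: matchable_def)
  next
    case False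
    \<comment> \<open>Nothing in \<open>C\<close> remains, so the walk from \<open>b\<close> next
      meets \<open>R\<close> at the root, after the \<open>length C\<close> darts of
      \<open>C\<close> and one more step.\<close>
    have pow: "(contour T ^^ n) b = xs ! ((length A + n) mod length xs)" for n
      using cyc_funpow[OF cyc(1), of "length A" n] split(1) by simp
    have "(contour T ^^ Suc (length C)) b = root_dart T"
      using pow[of "Suc (length C)"] split(1) cyc(2) by (simp add: hd_conv_nth)
    moreover have "(contour T ^^ m) b \<notin> R" if m: "0 < m" "m < Suc (length C)" for m
    proof -
      have "(contour T ^^ m) b = C ! (m - 1)"
        using pow[of m] m split(1) by (auto simp: nth_append nth_Cons')
      then show ?thesis using False m by simp
    qed
    ultimately have "next_in T R b (root_dart T)"
      unfolding next_in_def using assms(3) by blast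
    moreover have "root_dart T \<in> leaves T"
      using leaf[OF assms(3)] T(2) by (auto simp: buds_def)
    ultimately show False
      using assms(3,4) split(2) by (auto simp: matchable_def)
  qed
qed

lemma balanced_blossom_treeD:
  assumes "T \<in> balanced_blossom_trees 2"
  shows "rooted_at_leaf T" "tree T" "outer T xs \<Longrightarrow> well_charged T xs"
    "\<exists>M. closes\<^sup>*\<^sup>* T M \<and> leg_map 2 M"
proof -
  from assms have T: "blossom_tree T" "tree T" "single T (root_dart T)" "total_charge T = 2"
    by (auto simp: balanced_blossom_trees_def balanced_def)
  then obtain R where R: "unmatched T R" "\<nexists>b l. matchable T R b l" "root_dart T \<in> R"
    and leaf: "root_dart T \<in> leaves T"
    unfolding single_def by blast
  then have white: "white T (root_dart T)" by (simp add: leaves_def)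
  then show rooted: "rooted_at_leaf T"
    using T(2) by (simp add: rooted_at_leaf_def tree_def)
  show "tree T" by (rule T(2))
  show "outer T xs \<Longrightarrow> well_charged T xs"
    using blossom_tree_iff[OF T(2) white] T(1) by blast
  obtain M where M: "closes\<^sup>*\<^sup>* T M" "half_edges M = R"
    using unmatched_closes[OF R(1,3) rooted] by blast
  note pres = closes_preserves[OF M(1) rooted]
  have "buds M = {}"
    using final_unmatched_no_buds[OF rooted R(1,3,2)] unmatched_half_edges[OF R(1)] M(2) pres(4)
    by (auto simp: buds_def)
  \<comment> \<open>Glueing keeps the total charge, and without buds this is the number of
    leaves.\<close>
  moreover have "card (leaves M) = 2"
    using pres(6) T(4) \<open>buds M = {}\<close> by (simp add: total_charge_def)
  moreover have "root_dart M \<in> leaves M"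
    using R(3) M(2) pres(4,5) white by (simp add: leaves_def)
  ultimately have "leg_map 2 M"
    using pres(1) by (simp add: leg_map_def rooted_at_leaf_def)
  then show "\<exists>M. closes\<^sup>*\<^sup>* T M \<and> leg_map 2 M" using M(1) by blast
qed

lemma leg_map_opening:
  assumes "leg_map 2 M"
  shows "\<exists>T\<in>balanced_blossom_trees 2. closes\<^sup>*\<^sup>* T M"
proof -
  have M: "planar_map M" "card (leaves M) = 2" "buds M = {}" "root_dart M \<in> leaves M"
    using assms by (auto simp: leg_map_def)
  obtain ys where ys: "outer M ys" using outer_exists[OF M(1)] .
  obtain T xs where T: "closes\<^sup>*\<^sup>* T M" "openable T xs" "tree T"
    using opening_exists[OF leg_map_openable[OF assms ys]] by blast
  then have T': "rooted_at_leaf T" "outer T xs" "well_charged T xs"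
    by (auto simp: openable_def)
  note pres = closes_preserves[OF T(1) T'(1)]
  have white: "white T (root_dart T)" using T'(1) by (simp add: rooted_at_leaf_def)
  have "blossom_tree T"
    using blossom_tree_iff[OF T(3) white T'(2)] T'(3) by simp
  moreover have "total_charge T = 2"
    using pres(6) M(2,3) by (simp add: total_charge_def)
  \<comment> \<open>The closing of \<open>T\<close> to \<open>M\<close> is itself a run of the
    matching procedure; it stops for lack of buds and leaves the root unmatched.\<close>
  moreover have "single T (root_dart T)"
  proof -
    have "root_dart T \<in> leaves T"
      using white T'(1) by (simp add: rooted_at_leaf_def leaves_def planar_map_def)
    moreover have "unmatched T (half_edges M)"
      by (rule closes_filter_unmatched(2)[OF T(1) T'(1,2) ys])
    moreover have "\<not> matchable T (half_edges M) b l" for b l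
      using M(3) pres(4) by (auto simp: matchable_def buds_def)
    moreover have "root_dart T \<in> half_edges M"
      using M(4) pres(5) by (simp add: leaves_def)
    ultimately show ?thesis unfolding single_def by blast
  qed
  ultimately show ?thesis
    using T(1,3) unfolding balanced_blossom_trees_def balanced_def by blast
qed

text \<open>Totality on both sides gives definedness and surjectivity, and the equivalence in the
  last assumption gives well-definedness and injectivity. Classes are taken in \<open>U\<close> and
  may leave \<open>A\<close> and \<open>B\<close>, hence the intersection with \<open>A\<close> and
  the saturation by \<open>r\<close> in \<open>f\<close>.\<close>

lemma quotient_bijection:
  assumes eq: "equiv U r" and AB: "A \<subseteq> U" "B \<subseteq> U"
    and left: "\<And>x. x \<in> A \<Longrightarrow> \<exists>y\<in>B. c x y" and right: "\<And>y. y \<in> B \<Longrightarrow> \<exists>x\<in>A. c x y"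
    and resp: "\<And>x x' y y'. \<lbrakk>x \<in> A; x' \<in> A; y \<in> B; y' \<in> B; c x y; c x' y'\<rbrakk> \<Longrightarrow>
      (x, x') \<in> r \<longleftrightarrow> (y, y') \<in> r"
  defines "f \<equiv> \<lambda>X. r `` {y \<in> B. \<exists>x\<in>X \<inter> A. c x y}"
  shows "bij_betw f (A // r) (B // r)"
    "\<And>x y. \<lbrakk>x \<in> A; y \<in> B; c x y\<rbrakk> \<Longrightarrow> f (r `` {x}) = r `` {y}"
proof -
  show f: "f (r `` {x}) = r `` {y}" if xy: "x \<in> A" "y \<in> B" "c x y" for x y
  proof -
    have "(x, x) \<in> r" using eq AB xy(1) by (auto simp: equiv_def refl_on_def)
    then have "y \<in> {y \<in> B. \<exists>x'\<in>r `` {x} \<inter> A. c x' y}" using xy by blast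
    moreover have "(y, y') \<in> r" if "y' \<in> {y \<in> B. \<exists>x'\<in>r `` {x} \<inter> A. c x' y}" for y'
      using that resp xy by blast
    ultimately show ?thesis
      unfolding f_def using equiv_class_eq[OF eq] by blast
  qed
  show "bij_betw f (A // r) (B // r)"
    unfolding bij_betw_def
  proof
    show "inj_on f (A // r)"
    proof (rule inj_onI)
      fix X X' assume "X \<in> A // r" "X' \<in> A // r" "f X = f X'"
      then obtain x x' where x: "x \<in> A" "X = r `` {x}" "x' \<in> A" "X' = r `` {x'}"
        by (auto simp: quotient_def)
      obtain y y' where y: "y \<in> B" "c x y" "y' \<in> B" "c x' y'"
        using left x by blast
      then have "r `` {y} = r `` {y'}"
        using f x \<open>f X = f X'\<close> by metis
      then have "(y, y') \<in> r"
        using eq_equiv_class[OF _ eq] y AB by blast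
      then have "(x, x') \<in> r" using resp x y by blast
      then show "X = X'" using x equiv_class_eq[OF eq] by blast
    qed
    show "f ` (A // r) = B // r"
    proof (intro equalityI subsetI)
      fix Y assume "Y \<in> f ` (A // r)"
      then obtain x where x: "x \<in> A" "Y = f (r `` {x})" by (auto simp: quotient_def)
      then show "Y \<in> B // r" using left f by (metis quotientI)
    next
      fix Y assume "Y \<in> B // r"
      then obtain y where y: "y \<in> B" "Y = r `` {y}" by (auto simp: quotient_def)
      then obtain x where x: "x \<in> A" "c x y" using right by blast
      then show "Y \<in> f ` (A // r)" using f y quotientI[of x A r] by (metis image_eqI)
    qed
  qed
qed

theorem theorem8:
  shows "\<exists>f. bij_betw f (balanced_blossom_trees 2 // map_iso) (leg_maps 2 // map_iso) \<and>
    (\<forall>X \<in> balanced_blossom_trees 2 // map_iso. \<forall>T \<in> X. \<forall>M \<in> f X.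
       degree_distribution T = degree_distribution M)"
proof -
  let ?A = "balanced_blossom_trees 2" and ?B = "leg_maps 2"
  define f where "f = (\<lambda>X. map_iso `` {M \<in> ?B. \<exists>T\<in>X \<inter> ?A. closes\<^sup>*\<^sup>* T M})"
  have B: "rooted_at_leaf M" "buds M = {}" "planar_map M" if "M \<in> ?B" for M
    using that by (auto simp: leg_maps_def leg_map_def rooted_at_leaf_def leaves_def)
  have A: "rooted_at_leaf T" "planar_map T" if "T \<in> ?A" for T
    using balanced_blossom_treeD(1)[OF that] by (auto simp: rooted_at_leaf_def)
  have sub: "?A \<subseteq> {M. planar_map M}" "?B \<subseteq> {M. planar_map M}"
    using A(2) B(3) by auto
  have left: "\<exists>M\<in>?B. closes\<^sup>*\<^sup>* T M" if "T \<in> ?A" for T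
    using balanced_blossom_treeD(4)[OF that] by (auto simp: leg_maps_def)
  have right: "\<exists>T\<in>?A. closes\<^sup>*\<^sup>* T M" if "M \<in> ?B" for M
    using that leg_map_opening by (simp add: leg_maps_def)
  have resp: "(T, T') \<in> map_iso \<longleftrightarrow> (M, M') \<in> map_iso"
    if *: "T \<in> ?A" "T' \<in> ?A" "M \<in> ?B" "M' \<in> ?B" "closes\<^sup>*\<^sup>* T M" "closes\<^sup>*\<^sup>* T' M'" for T T' M M'
  proof
    \<comment> \<open>Imitating the closing of \<open>T\<close> on \<open>T'\<close> by the same
      relabelling ends in an isomorphic copy of \<open>M\<close>, also without buds, which
      uniqueness of the closure identifies with \<open>M'\<close>.\<close>
    assume "(T, T') \<in> map_iso"
    then obtain h where "map_isomorphism h T T'"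
      using map_iso_iff[OF A(1)[OF *(1)] A(1)[OF *(2)]] by blast
    then obtain M'' where M'': "closes\<^sup>*\<^sup>* T' M''" "map_isomorphism h M M''"
      using iso_closes[OF *(5)] by blast
    interpret map_isomorphism h M M'' by (rule M''(2))
    have "buds M'' \<subseteq> h ` buds M"
    proof
      fix e assume e: "e \<in> buds M''"
      then have "e \<in> h ` darts M" using bij by (auto simp: buds_def half_edges_def bij_betw_def)
      then show "e \<in> h ` buds M" using e h_leaves_buds(2) by blast
    qed
    then have "M'' = M'"
      using closure_unique[OF M''(1) *(6)] B(2)[OF *(3)] B(2)[OF *(4)] by simp
    then show "(M, M') \<in> map_iso"
      using map_iso_iff[OF B(1)[OF *(3)] B(1)[OF *(4)]] M''(2) by blast
  next
    \<comment> \<open>Imitating the opening of \<open>M\<close> on \<open>M'\<close> ends in a copy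
      of \<open>T\<close>, again a well-charged tree, which uniqueness of the opening identifies
      with \<open>T'\<close>.\<close>
    assume "(M, M') \<in> map_iso"
    then obtain h where "map_isomorphism h M M'"
      using map_iso_iff[OF B(1)[OF *(3)] B(1)[OF *(4)]] by blast
    then obtain T'' where T'': "closes\<^sup>*\<^sup>* T'' M'" "map_isomorphism h T T''"
      using iso_opens[OF *(5)] by blast
    interpret map_isomorphism h T T'' by (rule T''(2))
    obtain xs xs' where xs: "outer T xs" "outer T' xs'"
      using outer_exists[OF A(2)[OF *(1)]] outer_exists[OF A(2)[OF *(2)]] by metis
    note D = balanced_blossom_treeD[OF *(1)] and D' = balanced_blossom_treeD[OF *(2)]
    have "T'' = T'"
      by (rule opening_unique[OF T''(1) *(6) rooted(2) h_tree[OF D(2)] h_outer[OF xs(1)]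
          h_well_charged[OF xs(1) D(3)[OF xs(1)]] D'(1,2) xs(2) D'(3)[OF xs(2)]])
    then show "(T, T') \<in> map_iso"
      using map_iso_iff[OF A(1)[OF *(1)] A(1)[OF *(2)]] T''(2) by blast
  qed
  note q = quotient_bijection[OF equiv_map_iso sub, of "closes\<^sup>*\<^sup>*"]
  have "bij_betw f (?A // map_iso) (?B // map_iso)"
    unfolding f_def by (rule q(1)) (fact left right resp)+
  moreover have "degree_distribution T = degree_distribution M"
    if X: "X \<in> ?A // map_iso" and T: "T \<in> X" and M: "M \<in> f X" for X T M
  proof -
    obtain T0 where T0: "T0 \<in> ?A" "X = map_iso `` {T0}"
      using X by (auto simp: quotient_def)
    obtain M0 where M0: "M0 \<in> ?B" "closes\<^sup>*\<^sup>* T0 M0"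
      using left[OF T0(1)] by blast
    have "f X = map_iso `` {M0}"
      unfolding T0(2) f_def by (rule q(2)) (fact left right resp T0(1) M0)+
    then have iso: "(T0, T) \<in> map_iso" "(M0, M) \<in> map_iso"
      using T M T0(2) by auto
    \<comment> \<open>\<open>T\<close> and \<open>M\<close> are arbitrary members of their classes,
      so they are compared through the representatives \<open>T0\<close> and \<open>M0\<close>,
      which share their vertices and colours.\<close>
    have deg: "degree_distribution Q = degree_distribution P"
      if "(P, Q) \<in> map_iso" "rooted_at_leaf P" for P Q
      using that map_iso_iff[OF that(2) map_iso_rooted_at_leaf[OF that]]
        map_isomorphism.h_degree_distribution by blast
    have "degree_distribution M0 = degree_distribution T0"
      using closes_preserves(4,7)[OF M0(2) A(1)[OF T0(1)]] by (simp add: degree_distribution_def)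
    then show ?thesis
      using deg[OF iso(1) A(1)[OF T0(1)]] deg[OF iso(2) B(1)[OF M0(1)]] by simp
  qed
  ultimately show ?thesis by blast
qed

end
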